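(* Over $\mathsf{RCA}_0$, $\mathsf{RT}^2$ implies $\mathsf{AHT}$; that is, $\mathsf{RCA}_0 \vdash \mathsf{RT}^2 \rightarrow \mathsf{AHT}$.
   Context: $\mathsf{RCA}_0$ is the usual base system of reverse mathematics in second-order arithmetic; $\mathbf{N}$ denotes its first-order universe, and all principles below are statements in the language of second-order arithmetic. A map into $k$ means a map into $\{0,\dots,k-1\}$. $[\mathbf{N}]^2$ is the set of pairs $(x,y)$ of elements of $\mathbf{N}$ with $x<y$. $\mathsf{RT}^2_k$ (Ramsey's Theorem for pairs and $k$ colors): for every $f:[\mathbf{N}]^2\to k$ there is an infinite set $J\subseteq\mathbf{N}$ and a color $c<k$ such that $f(x,y)=c$ for all $x<y$ in $J$. $\mathsf{RT}^2$ denotes the single sentence $\forall k\,\mathsf{RT}^2_k$. For a positive integer $n=2^{t_1}+\dots+2^{t_p}$ with $t_1<\dots<t_p$, put $\lambda(n)=t_1$ and $\mu(n)=t_p$. A set $X$ of positive integers satisfies the Apartness Condition if for all $x,x'\in X$ with $x<x'$ we have $\mu(x)<\lambda(x')$. For an infinite set $H=\{h_1<h_2<h_3<\dots\}$, $AS(H)$ denotes the set of all finite sums of distinct adjacent elements of $H$, i.e. all sums $h_i+h_{i+1}+\dots+h_j$ with $i\le j$ (including single elements, $i=j$). $\mathsf{AHT}_k$ (Adjacent Hindman's Theorem for $k$ colors): for every $c:\mathbf{N}\to k$ there exists an infinite set $H$ of positive integers satisfying the Apartness Condition such that all elements of $AS(H)$ have the same $c$-color. $\mathsf{AHT}$ denotes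 the single sentence $\forall k\,\mathsf{AHT}_k$. *)

theory Defs
  imports Main
begin

section \<open>Second-order arithmetic\<close>

text \<open>Two-sorted language with signature 0, 1, +, *, <, = on numbers and membership of a number
in a set. Variables are de Bruijn indices, counted separately for numbers and for sets: index 0
refers to the innermost enclosing quantifier of the sort concerned. Set variables are the only set
terms, and there is no primitive equality between sets.\<close>

datatype tm = Var nat | Zero | One | Add tm tm | Mul tm tm

datatype fm =
    Fls
  | Eq tm tm
  | Less tm tm
  | Mem tm nat
  | Imp fm fm
  | AllN fm
  | AllS fm

abbreviation Neg :: "fm \<Rightarrow> fm" where "Neg p \<equiv> Imp p Fls"
abbreviation Con :: "fm \<Rightarrow> fm \<Rightarrow> fm" where "Con p q \<equiv> Neg (Imp p (Neg q))"
abbreviation Dis :: "fm \<Rightarrow> fm \<Rightarrow> fm" where "Dis p q \<equiv> Imp (Neg p) q"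
abbreviation Iff :: "fm \<Rightarrow> fm \<Rightarrow> fm" where "Iff p q \<equiv> Con (Imp p q) (Imp q p)"
abbreviation ExN :: "fm \<Rightarrow> fm" where "ExN p \<equiv> Neg (AllN (Neg p))"
abbreviation ExS :: "fm \<Rightarrow> fm" where "ExS p \<equiv> Neg (AllS (Neg p))"

text \<open>Simultaneous substitution of terms for number variables and of set variables for set
variables.\<close>

primrec tsub :: "(nat \<Rightarrow> tm) \<Rightarrow> tm \<Rightarrow> tm" where
  "tsub \<sigma> (Var i) = \<sigma> i"
| "tsub \<sigma> Zero = Zero"
| "tsub \<sigma> One = One"
| "tsub \<sigma> (Add t u) = Add (tsub \<sigma> t) (tsub \<sigma> u)"
| "tsub \<sigma> (Mul t u) = Mul (tsub \<sigma> t) (tsub \<sigma> u)"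

abbreviation tshift :: "tm \<Rightarrow> tm" where "tshift \<equiv> tsub (\<lambda>i. Var (Suc i))"

primrec fsub :: "(nat \<Rightarrow> tm) \<Rightarrow> (nat \<Rightarrow> nat) \<Rightarrow> fm \<Rightarrow> fm" where
  "fsub \<sigma> \<rho> Fls = Fls"
| "fsub \<sigma> \<rho> (Eq t u) = Eq (tsub \<sigma> t) (tsub \<sigma> u)"
| "fsub \<sigma> \<rho> (Less t u) = Less (tsub \<sigma> t) (tsub \<sigma> u)"
| "fsub \<sigma> \<rho> (Mem t X) = Mem (tsub \<sigma> t) (\<rho> X)"
| "fsub \<sigma> \<rho> (Imp p q) = Imp (fsub \<sigma> \<rho> p) (fsub \<sigma> \<rho> q)"
| "fsub \<sigma> \<rho> (AllN p) = AllN (fsub (case_nat (Var 0) (\<lambda>i. tshift (\<sigma> i))) \<rho> p)"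
| "fsub \<sigma> \<rho> (AllS p) = AllS (fsub \<sigma> (case_nat 0 (\<lambda>i. Suc (\<rho> i))) p)"

definition shiftN :: "fm \<Rightarrow> fm" where "shiftN = fsub (\<lambda>i. Var (Suc i)) id"
definition shiftS :: "fm \<Rightarrow> fm" where "shiftS = fsub Var Suc"
definition instN :: "tm \<Rightarrow> fm \<Rightarrow> fm" where "instN t = fsub (case_nat t Var) id"
definition instS :: "nat \<Rightarrow> fm \<Rightarrow> fm" where "instS X = fsub Var (case_nat X id)"

text \<open>Classical two-sorted natural deduction with equality. Shifting the hypotheses is the
eigenvariable condition.\<close>

inductive nd :: "fm list \<Rightarrow> fm \<Rightarrow> bool" where
  Assm: "p \<in> set \<Gamma> \<Longrightarrow> nd \<Gamma> p"
| ImpI: "nd (p # \<Gamma>) q \<Longrightarrow> nd \<Gamma> (Imp p q)"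
| ImpE: "nd \<Gamma> (Imp p q) \<Longrightarrow> nd \<Gamma> p \<Longrightarrow> nd \<Gamma> q"
| Raa: "nd (Neg p # \<Gamma>) Fls \<Longrightarrow> nd \<Gamma> p"
| AllNI: "nd (map shiftN \<Gamma>) p \<Longrightarrow> nd \<Gamma> (AllN p)"
| AllNE: "nd \<Gamma> (AllN p) \<Longrightarrow> nd \<Gamma> (instN t p)"
| AllSI: "nd (map shiftS \<Gamma>) p \<Longrightarrow> nd \<Gamma> (AllS p)"
| AllSE: "nd \<Gamma> (AllS p) \<Longrightarrow> nd \<Gamma> (instS X p)"
| Refl: "nd \<Gamma> (Eq t t)"
| Subst: "nd \<Gamma> (Eq t u) \<Longrightarrow> nd \<Gamma> (instN t p) \<Longrightarrow> nd \<Gamma> (instN u p)"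

definition provable :: "fm set \<Rightarrow> fm \<Rightarrow> bool" (infix "\<turnstile>" 50) where
  "T \<turnstile> p \<longleftrightarrow> (\<exists>\<Gamma>. set \<Gamma> \<subseteq> T \<and> nd \<Gamma> p)"


section \<open>Writing formulas with named variables\<close>

text \<open>To write concrete formulas with bound variables and without index arithmetic, a term is
represented by a function of the number \<open>n\<close> of number quantifiers it is placed under, a set variable
by a function of the number \<open>s\<close> of set quantifiers, and a formula by a function of both. The variable
bound by a quantifier at depth \<open>n\<close> has index \<open>m - Suc n\<close> when it occurs at depth \<open>m\<close>. A sentence is
read off at depth 0, 0.\<close>

type_synonym term' = "nat \<Rightarrow> tm"
type_synonym svar' = "nat \<Rightarrow> nat"
type_synonym form' = "nat \<Rightarrow> nat \<Rightarrow> fm"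

definition sentence :: "form' \<Rightarrow> fm" where "sentence p = p 0 0"

definition zero' :: "term'" ("\<^bold>0") where "\<^bold>0 = (\<lambda>n. Zero)"
definition one' :: "term'" ("\<^bold>1") where "\<^bold>1 = (\<lambda>n. One)"
definition add' :: "term' \<Rightarrow> term' \<Rightarrow> term'" (infixl "\<^bold>+" 65) where
  "(t \<^bold>+ u) = (\<lambda>n. Add (t n) (u n))"
definition mul' :: "term' \<Rightarrow> term' \<Rightarrow> term'" (infixl "\<^bold>*" 70) where
  "(t \<^bold>* u) = (\<lambda>n. Mul (t n) (u n))"

definition tru' :: "form'" ("\<^bold>\<top>") where "\<^bold>\<top> = (\<lambda>n s. Neg Fls)"
definition eq' :: "term' \<Rightarrow> term' \<Rightarrow> form'" (infix "\<^bold>=" 50) where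
  "(t \<^bold>= u) = (\<lambda>n s. Eq (t n) (u n))"
definition less' :: "term' \<Rightarrow> term' \<Rightarrow> form'" (infix "\<^bold><" 50) where
  "(t \<^bold>< u) = (\<lambda>n s. Less (t n) (u n))"
definition mem' :: "term' \<Rightarrow> svar' \<Rightarrow> form'" (infix "\<^bold>\<in>" 50) where
  "(t \<^bold>\<in> X) = (\<lambda>n s. Mem (t n) (X s))"
definition neg' :: "form' \<Rightarrow> form'" ("\<^bold>\<not> _" [40] 40) where
  "(\<^bold>\<not> p) = (\<lambda>n s. Neg (p n s))"
definition con' :: "form' \<Rightarrow> form' \<Rightarrow> form'" (infixr "\<^bold>\<and>" 35) where
  "(p \<^bold>\<and> q) = (\<lambda>n s. Con (p n s) (q n s))"
definition dis' :: "form' \<Rightarrow> form' \<Rightarrow> form'" (infixr "\<^bold>\<or>" 30) where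
  "(p \<^bold>\<or> q) = (\<lambda>n s. Dis (p n s) (q n s))"
definition imp' :: "form' \<Rightarrow> form' \<Rightarrow> form'" (infixr "\<^bold>\<longrightarrow>" 25) where
  "(p \<^bold>\<longrightarrow> q) = (\<lambda>n s. Imp (p n s) (q n s))"
definition iff' :: "form' \<Rightarrow> form' \<Rightarrow> form'" (infixr "\<^bold>\<longleftrightarrow>" 25) where
  "(p \<^bold>\<longleftrightarrow> q) = (\<lambda>n s. Iff (p n s) (q n s))"
definition allN' :: "(term' \<Rightarrow> form') \<Rightarrow> form'" (binder "\<^bold>\<forall>" 10) where
  "allN' F = (\<lambda>n s. AllN (F (\<lambda>m. Var (m - Suc n)) (Suc n) s))"
definition exN' :: "(term' \<Rightarrow> form') \<Rightarrow> form'" (binder "\<^bold>\<exists>" 10) where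
  "exN' F = (\<lambda>n s. ExN (F (\<lambda>m. Var (m - Suc n)) (Suc n) s))"
definition allS' :: "(svar' \<Rightarrow> form') \<Rightarrow> form'" (binder "\<^bold>\<forall>\<^sub>S" 10) where
  "allS' F = (\<lambda>n s. AllS (F (\<lambda>m. m - Suc s) n (Suc s)))"
definition exS' :: "(svar' \<Rightarrow> form') \<Rightarrow> form'" (binder "\<^bold>\<exists>\<^sub>S" 10) where
  "exS' F = (\<lambda>n s. ExS (F (\<lambda>m. m - Suc s) n (Suc s)))"

definition le' :: "term' \<Rightarrow> term' \<Rightarrow> form'" (infix "\<^bold>\<le>" 50) where
  "(t \<^bold>\<le> u) = (t \<^bold>< u \<^bold>\<or> t \<^bold>= u)"
definition ex1N' :: "(term' \<Rightarrow> form') \<Rightarrow> form'" (binder "\<^bold>\<exists>\<^sub>1" 10) where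
  "ex1N' F = (\<^bold>\<exists>y. F y \<^bold>\<and> (\<^bold>\<forall>z. F z \<^bold>\<longrightarrow> z \<^bold>= y))"


section \<open>The base theory\<close>

primrec tm_below :: "nat \<Rightarrow> tm \<Rightarrow> bool" where
  "tm_below m (Var i) \<longleftrightarrow> i < m"
| "tm_below m Zero \<longleftrightarrow> True"
| "tm_below m One \<longleftrightarrow> True"
| "tm_below m (Add t u) \<longleftrightarrow> tm_below m t \<and> tm_below m u"
| "tm_below m (Mul t u) \<longleftrightarrow> tm_below m t \<and> tm_below m u"

primrec fm_below :: "nat \<Rightarrow> nat \<Rightarrow> fm \<Rightarrow> bool" where
  "fm_below m k Fls \<longleftrightarrow> True"
| "fm_below m k (Eq t u) \<longleftrightarrow> tm_below m t \<and> tm_below m u"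
| "fm_below m k (Less t u) \<longleftrightarrow> tm_below m t \<and> tm_below m u"
| "fm_below m k (Mem t X) \<longleftrightarrow> tm_below m t \<and> X < k"
| "fm_below m k (Imp p q) \<longleftrightarrow> fm_below m k p \<and> fm_below m k q"
| "fm_below m k (AllN p) \<longleftrightarrow> fm_below (Suc m) k p"
| "fm_below m k (AllS p) \<longleftrightarrow> fm_below m (Suc k) p"

definition closures :: "fm \<Rightarrow> fm set" where
  "closures p = {(AllN ^^ m) ((AllS ^^ k) p) | m k. fm_below m k p}"

text \<open>Bounded formulas; free set variables are allowed. Shifting the bound \<open>t\<close> keeps the bound
variable from occurring in it. Bounded existential quantification is obtained as
\<open>Neg (AllN (Imp (Less (Var 0) (tshift t)) (Neg p)))\<close>.\<close>

inductive Delta00 :: "fm \<Rightarrow> bool" where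
  "Delta00 Fls"
| "Delta00 (Eq t u)"
| "Delta00 (Less t u)"
| "Delta00 (Mem t X)"
| "Delta00 p \<Longrightarrow> Delta00 q \<Longrightarrow> Delta00 (Imp p q)"
| "Delta00 p \<Longrightarrow> Delta00 (AllN (Imp (Less (Var 0) (tshift t)) p))"

definition Sigma01 :: "fm \<Rightarrow> bool" where
  "Sigma01 p \<longleftrightarrow> (\<exists>q. Delta00 q \<and> p = ExN q)"

definition Pi01 :: "fm \<Rightarrow> bool" where
  "Pi01 p \<longleftrightarrow> (\<exists>q. Delta00 q \<and> p = AllN q)"

definition basic_axioms :: "fm set" where
  "basic_axioms = sentence ` {
     \<^bold>\<forall>n. \<^bold>\<not> n \<^bold>+ \<^bold>1 \<^bold>= \<^bold>0,
     \<^bold>\<forall>m n. m \<^bold>+ \<^bold>1 \<^bold>= n \<^bold>+ \<^bold>1 \<^bold>\<longrightarrow> m \<^bold>= n,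
     \<^bold>\<forall>m. m \<^bold>+ \<^bold>0 \<^bold>= m,
     \<^bold>\<forall>m n. m \<^bold>+ (n \<^bold>+ \<^bold>1) \<^bold>= (m \<^bold>+ n) \<^bold>+ \<^bold>1,
     \<^bold>\<forall>m. m \<^bold>* \<^bold>0 \<^bold>= \<^bold>0,
     \<^bold>\<forall>m n. m \<^bold>* (n \<^bold>+ \<^bold>1) \<^bold>= (m \<^bold>* n) \<^bold>+ m,
     \<^bold>\<forall>m. \<^bold>\<not> m \<^bold>< \<^bold>0,
     \<^bold>\<forall>m n. m \<^bold>< n \<^bold>+ \<^bold>1 \<^bold>\<longleftrightarrow> (m \<^bold>< n \<^bold>\<or> m \<^bold>= n)}"

text \<open>In both schemes number variable 0 of \<open>p\<close> and \<open>q\<close> is the variable of the scheme and all other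
free variables are parameters. In comprehension, \<open>shiftS\<close> keeps the new set out of \<open>p\<close>.\<close>

definition induction_axiom :: "fm \<Rightarrow> fm" where
  "induction_axiom p =
     Imp (Con (instN Zero p)
              (AllN (Imp p (fsub (case_nat (Add (Var 0) One) (\<lambda>i. Var (Suc i))) id p))))
         (AllN p)"

definition comprehension_axiom :: "fm \<Rightarrow> fm \<Rightarrow> fm" where
  "comprehension_axiom p q =
     Imp (AllN (Iff p q)) (ExS (AllN (Iff (Mem (Var 0) 0) (shiftS p))))"

definition RCA0 :: "fm set" where
  "RCA0 = basic_axioms
     \<union> (\<Union>p \<in> {p. Sigma01 p}. closures (induction_axiom p))
     \<union> (\<Union>p \<in> {p. Sigma01 p}. \<Union>q \<in> {q. Pi01 q}. closures (comprehension_axiom p q))"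


section \<open>Functions, finite sums and binary expansions inside arithmetic\<close>

text \<open>The injective pairing code (i + j)^2 + i.\<close>

definition pair' :: "term' \<Rightarrow> term' \<Rightarrow> term'" ("\<^bold>\<langle>_,/ _\<^bold>\<rangle>") where
  "\<^bold>\<langle>t, u\<^bold>\<rangle> = (t \<^bold>+ u) \<^bold>* (t \<^bold>+ u) \<^bold>+ t"

text \<open>\<open>f\<close> is (the graph of) a function from the class \<open>D\<close> to the class \<open>R\<close>; \<open>f(x) = y\<close> is then
expressed by membership of the code of (x,y) in \<open>f\<close>.\<close>

definition function' :: "svar' \<Rightarrow> (term' \<Rightarrow> form') \<Rightarrow> (term' \<Rightarrow> form') \<Rightarrow> form'" where
  "function' f D R =
     ((\<^bold>\<forall>z. z \<^bold>\<in> f \<^bold>\<longrightarrow> (\<^bold>\<exists>x y. D x \<^bold>\<and> R y \<^bold>\<and> z \<^bold>= \<^bold>\<langle>x, y\<^bold>\<rangle>)) \<^bold>\<and>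
      (\<^bold>\<forall>x. D x \<^bold>\<longrightarrow> (\<^bold>\<exists>\<^sub>1y. R y \<^bold>\<and> \<^bold>\<langle>x, y\<^bold>\<rangle> \<^bold>\<in> f)))"

abbreviation (input) nats' :: "term' \<Rightarrow> form'" where
  "nats' \<equiv> \<lambda>x. \<^bold>\<top>"
abbreviation (input) below' :: "term' \<Rightarrow> term' \<Rightarrow> form'" where
  "below' k \<equiv> \<lambda>x. x \<^bold>< k"
abbreviation (input) between' :: "term' \<Rightarrow> term' \<Rightarrow> term' \<Rightarrow> form'" where
  "between' a b \<equiv> \<lambda>x. a \<^bold>\<le> x \<^bold>\<and> x \<^bold>\<le> b"
abbreviation (input) increasing_pairs' :: "term' \<Rightarrow> form'" where
  "increasing_pairs' \<equiv> \<lambda>z. \<^bold>\<exists>x y. x \<^bold>< y \<^bold>\<and> z \<^bold>= \<^bold>\<langle>x, y\<^bold>\<rangle>"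

definition strictly_increasing' :: "svar' \<Rightarrow> form'" where
  "strictly_increasing' f =
     (\<^bold>\<forall>i j u v. \<^bold>\<langle>i, u\<^bold>\<rangle> \<^bold>\<in> f \<^bold>\<and> \<^bold>\<langle>j, v\<^bold>\<rangle> \<^bold>\<in> f \<^bold>\<and> i \<^bold>< j \<^bold>\<longrightarrow> u \<^bold>< v)"

definition infinite' :: "svar' \<Rightarrow> form'" where
  "infinite' X = (\<^bold>\<forall>m. \<^bold>\<exists>n. m \<^bold>< n \<^bold>\<and> n \<^bold>\<in> X)"

text \<open>\<open>x = g(a) + \<dots> + g(b)\<close> for \<open>a \<le> b\<close>, where \<open>g i v\<close> expresses \<open>g(i) = v\<close>; \<open>s\<close> is the function of
partial sums.\<close>

definition finite_sum' ::
  "(term' \<Rightarrow> term' \<Rightarrow> form') \<Rightarrow> term' \<Rightarrow> term' \<Rightarrow> term' \<Rightarrow> form'" where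
  "finite_sum' g a b x =
     (\<^bold>\<exists>\<^sub>Ss. function' s (between' a b) nats' \<^bold>\<and>
        (\<^bold>\<exists>v. g a v \<^bold>\<and> \<^bold>\<langle>a, v\<^bold>\<rangle> \<^bold>\<in> s) \<^bold>\<and>
        (\<^bold>\<forall>i. a \<^bold>\<le> i \<^bold>\<and> i \<^bold>< b \<^bold>\<longrightarrow>
           (\<^bold>\<exists>u v. \<^bold>\<langle>i, u\<^bold>\<rangle> \<^bold>\<in> s \<^bold>\<and> g (i \<^bold>+ \<^bold>1) v \<^bold>\<and> \<^bold>\<langle>i \<^bold>+ \<^bold>1, u \<^bold>+ v\<^bold>\<rangle> \<^bold>\<in> s)) \<^bold>\<and>
        \<^bold>\<langle>b, x\<^bold>\<rangle> \<^bold>\<in> s)"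

text \<open>\<open>y = 2^t\<close>, by primitive recursion.\<close>

definition power_of_two' :: "term' \<Rightarrow> term' \<Rightarrow> form'" where
  "power_of_two' t y =
     (\<^bold>\<exists>\<^sub>Se. function' e nats' nats' \<^bold>\<and>
        \<^bold>\<langle>\<^bold>0, \<^bold>1\<^bold>\<rangle> \<^bold>\<in> e \<^bold>\<and>
        (\<^bold>\<forall>i u. \<^bold>\<langle>i, u\<^bold>\<rangle> \<^bold>\<in> e \<^bold>\<longrightarrow> \<^bold>\<langle>i \<^bold>+ \<^bold>1, (\<^bold>1 \<^bold>+ \<^bold>1) \<^bold>* u\<^bold>\<rangle> \<^bold>\<in> e) \<^bold>\<and>
        \<^bold>\<langle>t, y\<^bold>\<rangle> \<^bold>\<in> e)"

text \<open>\<open>n = 2^t(1) + \<dots> + 2^t(p)\<close> with \<open>t(1) < \<dots> < t(p)\<close>.\<close>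

definition binary_expansion' :: "term' \<Rightarrow> term' \<Rightarrow> svar' \<Rightarrow> form'" where
  "binary_expansion' n p t =
     (\<^bold>1 \<^bold>\<le> p \<^bold>\<and> function' t (between' \<^bold>1 p) nats' \<^bold>\<and> strictly_increasing' t \<^bold>\<and>
      finite_sum' (\<lambda>i v. \<^bold>\<exists>e. \<^bold>\<langle>i, e\<^bold>\<rangle> \<^bold>\<in> t \<^bold>\<and> power_of_two' e v) \<^bold>1 p n)"

text \<open>\<open>\<lambda>(n) = l\<close> and \<open>\<mu>(n) = m\<close>.\<close>

definition lambda' :: "term' \<Rightarrow> term' \<Rightarrow> form'" where
  "lambda' n l = (\<^bold>\<exists>p. \<^bold>\<exists>\<^sub>St. binary_expansion' n p t \<^bold>\<and> \<^bold>\<langle>\<^bold>1, l\<^bold>\<rangle> \<^bold>\<in> t)"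

definition mu' :: "term' \<Rightarrow> term' \<Rightarrow> form'" where
  "mu' n m = (\<^bold>\<exists>p. \<^bold>\<exists>\<^sub>St. binary_expansion' n p t \<^bold>\<and> \<^bold>\<langle>p, m\<^bold>\<rangle> \<^bold>\<in> t)"

definition apart' :: "svar' \<Rightarrow> form'" where
  "apart' X =
     (\<^bold>\<forall>x x'. x \<^bold>\<in> X \<^bold>\<and> x' \<^bold>\<in> X \<^bold>\<and> x \<^bold>< x' \<^bold>\<longrightarrow>
        (\<^bold>\<exists>m l. mu' x m \<^bold>\<and> lambda' x' l \<^bold>\<and> m \<^bold>< l))"

text \<open>\<open>x\<close> is a sum \<open>h(i) + \<dots> + h(j)\<close>, where \<open>h(1) < h(2) < \<dots>\<close> lists the elements of \<open>H\<close>.\<close>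

definition adjacent_sum' :: "svar' \<Rightarrow> term' \<Rightarrow> form'" where
  "adjacent_sum' H x =
     (\<^bold>\<exists>\<^sub>Sh. function' h (\<lambda>i. \<^bold>1 \<^bold>\<le> i) nats' \<^bold>\<and> strictly_increasing' h \<^bold>\<and>
        (\<^bold>\<forall>y. y \<^bold>\<in> H \<^bold>\<longleftrightarrow> (\<^bold>\<exists>i. \<^bold>1 \<^bold>\<le> i \<^bold>\<and> \<^bold>\<langle>i, y\<^bold>\<rangle> \<^bold>\<in> h)) \<^bold>\<and>
        (\<^bold>\<exists>i j. \<^bold>1 \<^bold>\<le> i \<^bold>\<and> i \<^bold>\<le> j \<^bold>\<and> finite_sum' (\<lambda>m v. \<^bold>\<langle>m, v\<^bold>\<rangle> \<^bold>\<in> h) i j x))"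


section \<open>The two principles\<close>

definition RT2_k' :: "term' \<Rightarrow> form'" where
  "RT2_k' k =
     (\<^bold>\<forall>\<^sub>Sf. function' f increasing_pairs' (below' k) \<^bold>\<longrightarrow>
        (\<^bold>\<exists>\<^sub>SJ. infinite' J \<^bold>\<and>
           (\<^bold>\<exists>c. c \<^bold>< k \<^bold>\<and>
              (\<^bold>\<forall>x y. x \<^bold>\<in> J \<^bold>\<and> y \<^bold>\<in> J \<^bold>\<and> x \<^bold>< y \<^bold>\<longrightarrow> \<^bold>\<langle>\<^bold>\<langle>x, y\<^bold>\<rangle>, c\<^bold>\<rangle> \<^bold>\<in> f))))"

definition RT2 :: fm where
  "RT2 = sentence (\<^bold>\<forall>k. RT2_k' k)"

definition AHT_k' :: "term' \<Rightarrow> form'" where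
  "AHT_k' k =
     (\<^bold>\<forall>\<^sub>Sc. function' c nats' (below' k) \<^bold>\<longrightarrow>
        (\<^bold>\<exists>\<^sub>SH. infinite' H \<^bold>\<and> (\<^bold>\<forall>x. x \<^bold>\<in> H \<^bold>\<longrightarrow> \<^bold>0 \<^bold>< x) \<^bold>\<and> apart' H \<^bold>\<and>
           (\<^bold>\<exists>i. i \<^bold>< k \<^bold>\<and> (\<^bold>\<forall>x. adjacent_sum' H x \<^bold>\<longrightarrow> \<^bold>\<langle>x, i\<^bold>\<rangle> \<^bold>\<in> c))))"

definition AHT :: fm where
  "AHT = sentence (\<^bold>\<forall>k. AHT_k' k)"

end

theory Submission
  imports Defs "HOL-Library.Countable_Set"
begin

text \<open>By a Henkin completeness theorem for the calculus it suffices to show that every model of the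
base theory that satisfies Ramsey's theorem satisfies the adjacent Hindman theorem.

Given \<open>c\<close>, colour the pair \<open>x < y\<close> by \<open>f(x, y) = c(2^y - 2^x)\<close>. If \<open>J = {j(1) < j(2) < \<dots>}\<close> is
homogeneous for \<open>f\<close>, let \<open>H\<close> consist of the numbers \<open>h(i) = 2^j(i+1) - 2^j(i)\<close>. Adjacent sums
telescope to \<open>2^j(b+1) - 2^j(a)\<close> and hence have the colour of \<open>J\<close>; the binary digits of \<open>h(i)\<close> are
those in positions \<open>j(i), \<dots>, j(i+1) - 1\<close>, so \<open>H\<close> is apart.

Inside a model the exponential function has to be constructed first. A finite set is coded by
\<open>(w, m)\<close> as the set of \<open>z\<close> with \<open>(z + 1) m + 1 dvd w\<close>, which makes \<open>y = 2^t\<close> a \<open>\<Sigma>\<close>-formula.\<close>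

section \<open>Substitution\<close>

text \<open>A model may be nonstandard, so facts about its numbers cannot be proved by induction in
  the metalanguage: every induction needs a Sigma-1 predicate of the model, and every set formed
  must be Delta-1. Definability is therefore tracked for ordinary HOL predicates by closure rules,
  without writing out formulas.

  Apartness asks for binary expansions, whose powers are values of a function that exists as a set.
  Witnesses for single values 2^t are thus not enough; the whole graph must be a set of the model.
  It is, since a code for another value refutes y = 2^t in a Sigma-1 way. With the graph as
  parameter, differences of powers become boundedly definable.

  The listing of H in an adjacent sum is quantified inside the formula and hence arbitrary; that its
  successive values come from adjoining intervals has to be proved from monotonicity.

  Arithmetic is carried out in a type class. A structure delivered by completeness cannot be turned
  into a type inside a proof, so one structure is fixed beforehand that refutes the implication if
  any model of the base theory on \<open>nat\<close> does.\<close>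

abbreviation lift :: "(nat \<Rightarrow> tm) \<Rightarrow> nat \<Rightarrow> tm" where
  "lift \<sigma> \<equiv> case_nat (Var 0) (\<lambda>i. tshift (\<sigma> i))"
abbreviation liftS :: "(nat \<Rightarrow> nat) \<Rightarrow> nat \<Rightarrow> nat" where
  "liftS \<rho> \<equiv> case_nat 0 (\<lambda>i. Suc (\<rho> i))"

lemma tsub_tsub: "tsub \<sigma> (tsub \<tau> t) = tsub (\<lambda>i. tsub \<sigma> (\<tau> i)) t"
  by (induction t) auto

lemma tsub_Var [simp]: "tsub Var t = t"
  by (induction t) auto

lemma lift_comp: "tsub (lift \<sigma>) (lift \<tau> i) = lift (\<lambda>i. tsub \<sigma> (\<tau> i)) i"
  by (cases i) (auto simp: tsub_tsub)

lemma fsub_fsub: "fsub \<sigma> \<rho> (fsub \<tau> \<pi> p) = fsub (\<lambda>i. tsub \<sigma> (\<tau> i)) (\<lambda>i. \<rho> (\<pi> i)) p"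
proof (induction p arbitrary: \<sigma> \<tau> \<rho> \<pi>)
  case (AllS p)
  have "(\<lambda>i. liftS \<rho> (liftS \<pi> i)) = liftS (\<lambda>i. \<rho> (\<pi> i))"
    by (auto simp: fun_eq_iff split: nat.split)
  with AllS show ?case by simp
qed (auto simp: tsub_tsub lift_comp)

lemma lift_Var [simp]: "case_nat (Var 0) (\<lambda>i. Var (Suc i)) = Var"
  by (auto simp: fun_eq_iff split: nat.split)

lemma liftS_id [simp]: "case_nat 0 Suc = (\<lambda>i. i)"
  by (auto simp: fun_eq_iff split: nat.split)

lemma fsub_id [simp]: "fsub Var (\<lambda>i. i) p = p"
  by (induction p) auto

lemma fsub_id' [simp]: "fsub Var id p = p"
  by (simp add: id_def)

lemma tsub_cong: "tm_below m t \<Longrightarrow> (\<And>i. i < m \<Longrightarrow> \<sigma> i = \<sigma>' i) \<Longrightarrow> tsub \<sigma> t = tsub \<sigma>' t"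
  by (induction t) auto

lemma fsub_cong:
  "fm_below m k p \<Longrightarrow> (\<And>i. i < m \<Longrightarrow> \<sigma> i = \<sigma>' i) \<Longrightarrow> (\<And>i. i < k \<Longrightarrow> \<rho> i = \<rho>' i) \<Longrightarrow>
    fsub \<sigma> \<rho> p = fsub \<sigma>' \<rho>' p"
proof (induction p arbitrary: m k \<sigma> \<sigma>' \<rho> \<rho>')
  case (AllN p)
  have "fsub (lift \<sigma>) \<rho> p = fsub (lift \<sigma>') \<rho>' p"
    by (rule AllN.IH[where m = "Suc m" and k = k]) (use AllN.prems in \<open>auto split: nat.split\<close>)
  then show ?case by simp
next
  case (AllS p)
  have "fsub \<sigma> (liftS \<rho>) p = fsub \<sigma>' (liftS \<rho>') p"
    by (rule AllS.IH[where m = m and k = "Suc k"]) (use AllS.prems in \<open>auto split: nat.split\<close>)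
  then show ?case by simp
next
  case (Eq t u)
  then show ?case using tsub_cong[of m t \<sigma> \<sigma>'] tsub_cong[of m u \<sigma> \<sigma>'] by simp
next
  case (Less t u)
  then show ?case using tsub_cong[of m t \<sigma> \<sigma>'] tsub_cong[of m u \<sigma> \<sigma>'] by simp
next
  case (Mem t X)
  then show ?case using tsub_cong[of m t \<sigma> \<sigma>'] by simp
next
  case (Imp p q)
  then show ?case using Imp.IH[of m k \<sigma> \<sigma>' \<rho> \<rho>'] by simp
qed auto

lemma tm_below_mono: "tm_below m t \<Longrightarrow> m \<le> m' \<Longrightarrow> tm_below m' t"
  by (induction t) auto

lemma fm_below_mono: "fm_below m k p \<Longrightarrow> m \<le> m' \<Longrightarrow> k \<le> k' \<Longrightarrow> fm_below m' k' p"
  by (induction p arbitrary: m k m' k') (auto intro: tm_below_mono)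

lemma tm_below_exists: "\<exists>m. tm_below m t"
proof (induction t)
  case (Add t u)
  then obtain a b where "tm_below a t" "tm_below b u" by blast
  then have "tm_below (max a b) (Add t u)" by (auto intro: tm_below_mono)
  then show ?case by blast
next
  case (Mul t u)
  then obtain a b where "tm_below a t" "tm_below b u" by blast
  then have "tm_below (max a b) (Mul t u)" by (auto intro: tm_below_mono)
  then show ?case by blast
qed auto

lemma fm_below_exists: "\<exists>m. fm_below m m p"
proof -
  have t: "\<exists>m. tm_below m t \<and> tm_below m u" for t u
    using tm_below_exists[of "Add t u"] by auto
  show ?thesis
  proof (induction p)
    case (Mem t X)
    obtain m where "tm_below m t" using tm_below_exists by blast
    then have "fm_below (max m (Suc X)) (max m (Suc X)) (Mem t X)"
      by (auto intro: tm_below_mono)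
    then show ?case by blast
  next
    case (Imp p q)
    then obtain a b where "fm_below a a p" "fm_below b b q" by blast
    then have "fm_below (max a b) (max a b) (Imp p q)" by (auto intro: fm_below_mono)
    then show ?case by blast
  next
    case (AllN p)
    then obtain a where "fm_below a a p" by blast
    then have "fm_below a a (AllN p)" by (auto intro: fm_below_mono)
    then show ?case by blast
  next
    case (AllS p)
    then obtain a where "fm_below a a p" by blast
    then have "fm_below a a (AllS p)" by (auto intro: fm_below_mono)
    then show ?case by blast
  qed (use t in auto)
qed

text \<open>Source of fresh variables: index \<open>m\<close> of either sort occurs free in no
  formula of the finite set.\<close>

lemma fm_below_finite:
  assumes "finite F"
  shows "\<exists>m. \<forall>p\<in>F. fm_below m m p"
  using assms
proof (induction F)
  case (insert p F)
  then obtain m where m: "\<forall>q\<in>F. fm_below m m q" by blast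
  obtain a where a: "fm_below a a p" using fm_below_exists by blast
  have "\<forall>q\<in>insert p F. fm_below (max m a) (max m a) q"
    using m a by (auto intro: fm_below_mono)
  then show ?case by blast
qed auto

section \<open>Weakening and substitution in derivations\<close>

lemma nd_weaken: "nd \<Gamma> p \<Longrightarrow> set \<Gamma> \<subseteq> set \<Delta> \<Longrightarrow> nd \<Delta> p"
proof (induction arbitrary: \<Delta> rule: nd.induct)
  case (ImpI p \<Gamma> q)
  have "nd (p # \<Delta>) q" by (rule ImpI.IH) (use ImpI.prems in auto)
  then show ?case by (rule nd.ImpI)
next
  case (Raa p \<Gamma>)
  have "nd (Neg p # \<Delta>) Fls" by (rule Raa.IH) (use Raa.prems in auto)
  then show ?case by (rule nd.Raa)
next
  case (AllNI \<Gamma> p)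
  have "nd (map shiftN \<Delta>) p" by (rule AllNI.IH) (use AllNI.prems in auto)
  then show ?case by (rule nd.AllNI)
next
  case (AllSI \<Gamma> p)
  have "nd (map shiftS \<Delta>) p" by (rule AllSI.IH) (use AllSI.prems in auto)
  then show ?case by (rule nd.AllSI)
qed (blast intro: nd.intros)+

lemma fsub_instN: "fsub \<sigma> \<rho> (instN t p) = instN (tsub \<sigma> t) (fsub (lift \<sigma>) \<rho> p)"
  unfolding instN_def fsub_fsub
  by (rule arg_cong2[where f = "\<lambda>\<sigma> \<rho>. fsub \<sigma> \<rho> p"])
     (auto simp: fun_eq_iff tsub_tsub split: nat.split)

lemma fsub_instS: "fsub \<sigma> \<rho> (instS X p) = instS (\<rho> X) (fsub \<sigma> (liftS \<rho>) p)"
  unfolding instS_def fsub_fsub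
  by (rule arg_cong2[where f = "\<lambda>\<sigma> \<rho>. fsub \<sigma> \<rho> p"]) (auto simp: fun_eq_iff split: nat.split)

lemma fsub_shiftN: "fsub (lift \<sigma>) \<rho> (shiftN p) = shiftN (fsub \<sigma> \<rho> p)"
  by (simp add: shiftN_def fsub_fsub)

lemma fsub_shiftS: "fsub \<sigma> (liftS \<rho>) (shiftS p) = shiftS (fsub \<sigma> \<rho> p)"
  by (simp add: shiftS_def fsub_fsub)

text \<open>The quantifier rules survive because a lifted substitution commutes with the shift of
  the hypotheses, so the eigenvariable condition is preserved. It is used to rename fresh
  variables.\<close>

lemma nd_fsub: "nd \<Gamma> p \<Longrightarrow> nd (map (fsub \<sigma> \<rho>) \<Gamma>) (fsub \<sigma> \<rho> p)"
proof (induction arbitrary: \<sigma> \<rho> rule: nd.induct)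
  case (AllNI \<Gamma> p)
  have "nd (map (fsub (lift \<sigma>) \<rho>) (map shiftN \<Gamma>)) (fsub (lift \<sigma>) \<rho> p)" by (rule AllNI.IH)
  also have "map (fsub (lift \<sigma>) \<rho>) (map shiftN \<Gamma>) = map shiftN (map (fsub \<sigma> \<rho>) \<Gamma>)"
    by (simp add: fsub_shiftN)
  finally show ?case by (simp add: nd.AllNI)
next
  case (AllSI \<Gamma> p)
  have "nd (map (fsub \<sigma> (liftS \<rho>)) (map shiftS \<Gamma>)) (fsub \<sigma> (liftS \<rho>) p)" by (rule AllSI.IH)
  also have "map (fsub \<sigma> (liftS \<rho>)) (map shiftS \<Gamma>) = map shiftS (map (fsub \<sigma> \<rho>) \<Gamma>)"
    by (simp add: fsub_shiftS)
  finally show ?case by (simp add: nd.AllSI)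
next
  case (AllNE \<Gamma> p t)
  have "nd (map (fsub \<sigma> \<rho>) \<Gamma>) (AllN (fsub (lift \<sigma>) \<rho> p))" using AllNE.IH[of \<sigma> \<rho>] by simp
  then show ?case unfolding fsub_instN by (rule nd.AllNE)
next
  case (AllSE \<Gamma> p X)
  have "nd (map (fsub \<sigma> \<rho>) \<Gamma>) (AllS (fsub \<sigma> (liftS \<rho>) p))" using AllSE.IH[of \<sigma> \<rho>] by simp
  then show ?case unfolding fsub_instS by (rule nd.AllSE)
next
  case (Subst \<Gamma> t u p)
  then show ?case unfolding fsub_instN fsub.simps by (blast intro: nd.Subst)
next
  case (ImpI p \<Gamma> q)
  then show ?case by (auto intro: nd.ImpI)
next
  case (ImpE \<Gamma> p q)
  then show ?case unfolding fsub.simps by (blast intro: nd.ImpE)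
next
  case (Raa p \<Gamma>)
  have "nd (map (fsub \<sigma> \<rho>) (Neg p # \<Gamma>)) Fls" using Raa.IH[of \<sigma> \<rho>] by simp
  then show ?case by (auto intro: nd.Raa)
qed (auto intro: nd.intros)

text \<open>The renaming that sends the fresh variable \<open>m\<close> to index 0 and every other
  index one up acts on the hypotheses as the shift and undoes the instantiation of \<open>p\<close>;
  the introduction rule then applies.\<close>

lemma nd_generalizeN:
  assumes "nd \<Gamma> (instN (Var m) p)" "\<forall>q\<in>set \<Gamma>. fm_below m k q" "fm_below (Suc m) k' p"
  shows "nd \<Gamma> (AllN p)"
proof -
  let ?\<sigma> = "\<lambda>i. if i = m then Var 0 else Var (Suc i)"
  have "map (fsub ?\<sigma> id) \<Gamma> = map shiftN \<Gamma>"
    unfolding shiftN_def using assms(2) by (auto intro!: fsub_cong)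
  moreover have "fsub ?\<sigma> id (instN (Var m) p) = p"
  proof -
    have "fsub ?\<sigma> id (instN (Var m) p) = fsub Var id p"
      unfolding instN_def fsub_fsub
      by (rule fsub_cong[OF assms(3)]) (auto split: nat.split)
    then show ?thesis by simp
  qed
  ultimately have "nd (map shiftN \<Gamma>) p"
    using nd_fsub[OF assms(1), of ?\<sigma> id] by argo
  then show ?thesis by (rule nd.AllNI)
qed

lemma nd_generalizeS:
  assumes "nd \<Gamma> (instS k p)" "\<forall>q\<in>set \<Gamma>. fm_below m k q" "fm_below m' (Suc k) p"
  shows "nd \<Gamma> (AllS p)"
proof -
  let ?\<rho> = "\<lambda>i. if i = k then 0 else Suc i"
  have "map (fsub Var ?\<rho>) \<Gamma> = map shiftS \<Gamma>"
    unfolding shiftS_def using assms(2) by (auto intro!: fsub_cong)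
  moreover have "fsub Var ?\<rho> (instS k p) = p"
  proof -
    have "fsub Var ?\<rho> (instS k p) = fsub Var id p"
      unfolding instS_def fsub_fsub
      by (rule fsub_cong[OF assms(3)]) (auto split: nat.split)
    then show ?thesis by simp
  qed
  ultimately have "nd (map shiftS \<Gamma>) p"
    using nd_fsub[OF assms(1), of Var ?\<rho>] by argo
  then show ?thesis by (rule nd.AllSI)
qed

section \<open>Completeness\<close>

lemma provable_ImpE: "T \<turnstile> Imp p q \<Longrightarrow> T \<turnstile> p \<Longrightarrow> T \<turnstile> q"
proof -
  assume "T \<turnstile> Imp p q" "T \<turnstile> p"
  then obtain \<Gamma> \<Delta> where "set \<Gamma> \<subseteq> T" "nd \<Gamma> (Imp p q)" "set \<Delta> \<subseteq> T" "nd \<Delta> p"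
    unfolding provable_def by blast
  moreover from this have "nd (\<Gamma> @ \<Delta>) (Imp p q)" "nd (\<Gamma> @ \<Delta>) p" by (auto intro: nd_weaken)
  ultimately show ?thesis
    unfolding provable_def by (intro exI[of _ "\<Gamma> @ \<Delta>"]) (auto intro: nd.ImpE)
qed

lemma provable_insert:
  assumes "insert p T \<turnstile> q"
  shows "T \<turnstile> Imp p q"
proof -
  from assms obtain \<Gamma> where "set \<Gamma> \<subseteq> insert p T" "nd \<Gamma> q"
    unfolding provable_def by blast
  then have "nd (p # removeAll p \<Gamma>) q" by (auto intro: nd_weaken)
  with \<open>set \<Gamma> \<subseteq> insert p T\<close> show ?thesis
    unfolding provable_def by (intro exI[of _ "removeAll p \<Gamma>"]) (auto intro: nd.ImpI)
qed

lemma provable_Raa: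
  assumes "insert (Neg p) T \<turnstile> Fls"
  shows "T \<turnstile> p"
proof -
  from provable_insert[OF assms] obtain \<Gamma> where "set \<Gamma> \<subseteq> T" "nd \<Gamma> (Neg (Neg p))"
    unfolding provable_def by blast
  then have "nd (Neg p # \<Gamma>) (Neg (Neg p))" by (auto intro: nd_weaken)
  then have "nd (Neg p # \<Gamma>) Fls" by (rule nd.ImpE) (auto intro: nd.Assm)
  then have "nd \<Gamma> p" by (rule nd.Raa)
  with \<open>set \<Gamma> \<subseteq> T\<close> show ?thesis unfolding provable_def by blast
qed

lemma provable_assm: "p \<in> T \<Longrightarrow> T \<turnstile> p"
  unfolding provable_def by (intro exI[of _ "[p]"]) (auto intro: nd.Assm)

section \<open>Consistency and Henkin sets\<close>

abbreviation consistent :: "fm set \<Rightarrow> bool" where "consistent T \<equiv> \<not> T \<turnstile> Fls"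

lemma consistent_decide:
  assumes "consistent T"
  shows "consistent (insert p T) \<or> consistent (insert (Neg p) T)"
  using assms provable_ImpE[of T p Fls] provable_insert[of p T Fls] provable_Raa[of p T] by blast

text \<open>Counterexamples to refuted universal formulas are terms and set variables of the given
  language; free variables take the place of Henkin constants.\<close>

definition decided :: "fm \<Rightarrow> fm set \<Rightarrow> bool" where
  "decided p F \<longleftrightarrow> p \<in> F \<or> Neg p \<in> F \<and>
     (\<forall>q. p = AllN q \<longrightarrow> (\<exists>t. Neg (instN t q) \<in> F)) \<and>
     (\<forall>q. p = AllS q \<longrightarrow> (\<exists>X. Neg (instS X q) \<in> F))"

lemma decided_mono: "decided p F \<Longrightarrow> F \<subseteq> G \<Longrightarrow> decided p G"
  unfolding decided_def by blast

text \<open>\<open>T\<close> consists of sentences and \<open>F\<close> is finite, so a variable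
  \<open>m\<close> fresh for all of them exists. If \<open>p\<close> cannot be added, its negation
  can, and the negated instance at \<open>m\<close> can follow: an inconsistency would prove the
  instance and, by generalization, \<open>p\<close> itself.\<close>

lemma henkin_step:
  assumes T: "\<forall>q\<in>T. fm_below 0 0 q" and F: "finite F" "consistent (T \<union> F)"
  shows "\<exists>G. finite G \<and> F \<subseteq> G \<and> consistent (T \<union> G) \<and> decided p G"
proof (cases "consistent (insert p (T \<union> F))")
  case True
  then show ?thesis
    using F by (intro exI[of _ "insert p F"]) (auto simp: decided_def)
next
  case False
  then have c: "consistent (insert (Neg p) (T \<union> F))"
    using consistent_decide F(2) by blast
  obtain m where "\<forall>q\<in>insert p F. fm_below m m q"
    using fm_below_finite F(1) by blast
  then have m: "\<forall>q\<in>insert (Neg p) (T \<union> F). fm_below m m q"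
    using T by (auto intro: fm_below_mono)
  have *: ?thesis if "consistent (insert (Neg r) (insert (Neg p) (T \<union> F)))"
      "\<And>q. p = AllN q \<Longrightarrow> r = instN (Var m) q" "\<And>q. p = AllS q \<Longrightarrow> r = instS m q" for r
    using F that by (intro exI[of _ "insert (Neg r) (insert (Neg p) F)"]) (auto simp: decided_def)
  have contra: False if "nd \<Gamma> p" "set \<Gamma> \<subseteq> insert (Neg p) (T \<union> F)" for \<Gamma>
  proof -
    have "insert (Neg p) (T \<union> F) \<turnstile> p" unfolding provable_def using that by blast
    moreover have "insert (Neg p) (T \<union> F) \<turnstile> Neg p" by (rule provable_assm) simp
    ultimately show False using c provable_ImpE by blast
  qed
  show ?thesis
  proof (cases "\<exists>q. p = AllN q \<or> p = AllS q")
    case False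
    with c show ?thesis by (intro exI[of _ "insert (Neg p) F"]) (auto simp: decided_def F)
  next
    case True
    then consider q where "p = AllN q" | q where "p = AllS q" by blast
    then show ?thesis
    proof cases
      case (1 q)
      have "consistent (insert (Neg (instN (Var m) q)) (insert (Neg p) (T \<union> F)))"
      proof
        assume "insert (Neg (instN (Var m) q)) (insert (Neg p) (T \<union> F)) \<turnstile> Fls"
        then obtain \<Gamma> where g: "set \<Gamma> \<subseteq> insert (Neg p) (T \<union> F)" "nd \<Gamma> (instN (Var m) q)"
          using provable_Raa unfolding provable_def by blast
        have "nd \<Gamma> (AllN q)"
          by (rule nd_generalizeN[OF g(2), where k = m and k' = m]) (use g m 1 in auto)
        then show False using contra g(1) 1 by blast
      qed
      then show ?thesis by (rule *) (use 1 in auto)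
    next
      case (2 q)
      have "consistent (insert (Neg (instS m q)) (insert (Neg p) (T \<union> F)))"
      proof
        assume "insert (Neg (instS m q)) (insert (Neg p) (T \<union> F)) \<turnstile> Fls"
        then obtain \<Gamma> where g: "set \<Gamma> \<subseteq> insert (Neg p) (T \<union> F)" "nd \<Gamma> (instS m q)"
          using provable_Raa unfolding provable_def by blast
        have "nd \<Gamma> (AllS q)"
          by (rule nd_generalizeS[OF g(2), where m = m and m' = m]) (use g m 2 in auto)
        then show False using contra g(1) 2 by blast
      qed
      then show ?thesis by (rule *) (use 2 in auto)
    qed
  qed
qed

instance tm :: countable by countable_datatype
instance fm :: countable by countable_datatype

text \<open>Stage \<open>Suc n\<close> decides formula number \<open>n\<close>. The union stays
  consistent because a derivation uses finitely many hypotheses, all present at one stage.\<close>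

lemma henkin_extension:
  assumes T: "\<forall>q\<in>T. fm_below 0 0 q" and c: "consistent T"
  obtains H where "T \<subseteq> H" "consistent H" "\<And>p. decided p H"
proof -
  have "\<exists>F. \<forall>n. (finite (F n) \<and> consistent (T \<union> F n)) \<and>
      (F n \<subseteq> F (Suc n) \<and> decided (from_nat n) (F (Suc n)))"
  proof (rule dependent_nat_choice)
    show "\<exists>F. finite F \<and> consistent (T \<union> F)" using c by (intro exI[of _ "{}"]) auto
    show "\<exists>G. (finite G \<and> consistent (T \<union> G)) \<and> F \<subseteq> G \<and> decided (from_nat n) G"
      if "finite F \<and> consistent (T \<union> F)" for F n
      using henkin_step[OF T, of F] that by blast
  qed
  then obtain F where F: "\<And>n. consistent (T \<union> F n)" "\<And>n. F n \<subseteq> F (Suc n)"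
    "\<And>n. decided (from_nat n) (F (Suc n))" by blast
  have mono: "m \<le> n \<Longrightarrow> F m \<subseteq> F n" for m n using F(2) lift_Suc_mono_le by metis
  let ?H = "T \<union> (\<Union>n. F n)"
  have fin: "\<exists>n. set \<Gamma> \<subseteq> T \<union> F n" if "set \<Gamma> \<subseteq> ?H" for \<Gamma>
    using that
  proof (induction \<Gamma>)
    case (Cons p \<Gamma>)
    then obtain n where n: "set \<Gamma> \<subseteq> T \<union> F n" by auto
    obtain k where "p \<in> T \<union> F k" using Cons.prems by auto
    with n mono[of k "max k n"] mono[of n "max k n"]
    have "set (p # \<Gamma>) \<subseteq> T \<union> F (max k n)" by auto
    then show ?case by blast
  qed auto
  show ?thesis
  proof
    show "T \<subseteq> ?H" by blast
    show "consistent ?H"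
      unfolding provable_def using F(1) fin unfolding provable_def by meson
    show "decided p ?H" for p
      by (rule decided_mono[of p "F (Suc (to_nat p))"]) (use F(3)[of "to_nat p"] in auto)
  qed
qed

section \<open>Structures with a designated family of sets\<close>

record 'a l2_structure =
  zeroM :: 'a
  oneM :: 'a
  addM :: "'a \<Rightarrow> 'a \<Rightarrow> 'a"
  mulM :: "'a \<Rightarrow> 'a \<Rightarrow> 'a"
  lessM :: "'a \<Rightarrow> 'a \<Rightarrow> bool"
  setsM :: "'a set set"

primrec teval :: "'a l2_structure \<Rightarrow> (nat \<Rightarrow> 'a) \<Rightarrow> tm \<Rightarrow> 'a" where
  "teval M e (Var i) = e i"
| "teval M e Zero = zeroM M"
| "teval M e One = oneM M"
| "teval M e (Add t u) = addM M (teval M e t) (teval M e u)"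
| "teval M e (Mul t u) = mulM M (teval M e t) (teval M e u)"

primrec sat :: "'a l2_structure \<Rightarrow> (nat \<Rightarrow> 'a) \<Rightarrow> (nat \<Rightarrow> 'a set) \<Rightarrow> fm \<Rightarrow> bool" where
  "sat M e E Fls \<longleftrightarrow> False"
| "sat M e E (Eq t u) \<longleftrightarrow> teval M e t = teval M e u"
| "sat M e E (Less t u) \<longleftrightarrow> lessM M (teval M e t) (teval M e u)"
| "sat M e E (Mem t X) \<longleftrightarrow> teval M e t \<in> E X"
| "sat M e E (Imp p q) \<longleftrightarrow> (sat M e E p \<longrightarrow> sat M e E q)"
| "sat M e E (AllN p) \<longleftrightarrow> (\<forall>x. sat M (case_nat x e) E p)"
| "sat M e E (AllS p) \<longleftrightarrow> (\<forall>X\<in>setsM M. sat M e (case_nat X E) p)"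

text \<open>Free variables count as universally quantified, so a formula and its universal closures
  hold in the same structures.\<close>

definition models :: "'a l2_structure \<Rightarrow> fm \<Rightarrow> bool" where
  "models M p \<longleftrightarrow> (\<forall>e E. range E \<subseteq> setsM M \<longrightarrow> sat M e E p)"

lemma teval_tsub: "teval M e (tsub \<sigma> t) = teval M (\<lambda>i. teval M e (\<sigma> i)) t"
  by (induction t) auto

lemma teval_tshift [simp]: "teval M (case_nat x e) (tshift t) = teval M e t"
  by (simp add: teval_tsub)

lemma sat_fsub: "sat M e E (fsub \<sigma> \<rho> p) = sat M (\<lambda>i. teval M e (\<sigma> i)) (\<lambda>i. E (\<rho> i)) p"
proof (induction p arbitrary: e E \<sigma> \<rho>)
  case (AllN p)
  have "(\<lambda>i. teval M (case_nat x e) (lift \<sigma> i)) = case_nat x (\<lambda>i. teval M e (\<sigma> i))" for x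
    by (auto simp: fun_eq_iff split: nat.split)
  with AllN show ?case by simp
next
  case (AllS p)
  have "(\<lambda>i. case_nat X E (liftS \<rho> i)) = case_nat X (\<lambda>i. E (\<rho> i))" for X
    by (auto simp: fun_eq_iff split: nat.split)
  with AllS show ?case by simp
qed (auto simp: teval_tsub)

section \<open>The term model\<close>

locale henkin =
  fixes H :: "fm set"
  assumes consistent: "consistent H" and decided: "\<And>p. decided p H"
begin

lemma closed: "set \<Gamma> \<subseteq> H \<Longrightarrow> nd \<Gamma> p \<Longrightarrow> p \<in> H"
  using consistent decided[of p] provable_ImpE[of H p Fls] provable_assm[of _ H]
  unfolding decided_def provable_def by blast

lemma mem_Fls: "Fls \<notin> H"
  using consistent provable_assm by blast

lemma mem_Imp: "Imp p q \<in> H \<longleftrightarrow> (p \<in> H \<longrightarrow> q \<in> H)"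
proof (intro iffI impI)
  assume "Imp p q \<in> H" "p \<in> H"
  then show "q \<in> H"
    by (intro closed[of "[Imp p q, p]"] nd.ImpE[of _ p q] nd.Assm) auto
next
  assume "p \<in> H \<longrightarrow> q \<in> H"
  then consider "q \<in> H" | "Neg p \<in> H" using decided[of p] unfolding decided_def by blast
  then show "Imp p q \<in> H"
  proof cases
    case 1
    then show ?thesis by (intro closed[of "[q]"] nd.ImpI nd.Assm) auto
  next
    case 2
    have "nd [Neg q, p, Neg p] Fls" by (rule nd.ImpE[of _ p]) (auto intro: nd.Assm)
    then have "nd [Neg p] (Imp p q)" by (intro nd.ImpI) (rule nd.Raa)
    with 2 show ?thesis using closed[of "[Neg p]"] by auto
  qed
qed

lemma mem_AllN: "AllN p \<in> H \<longleftrightarrow> (\<forall>t. instN t p \<in> H)"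
proof
  assume "AllN p \<in> H"
  then show "\<forall>t. instN t p \<in> H"
    by (intro allI closed[of "[AllN p]"] nd.AllNE nd.Assm) auto
next
  assume "\<forall>t. instN t p \<in> H"
  then show "AllN p \<in> H"
    using decided[of "AllN p"] mem_Fls by (auto simp: decided_def mem_Imp)
qed

lemma mem_AllS: "AllS p \<in> H \<longleftrightarrow> (\<forall>X. instS X p \<in> H)"
proof
  assume "AllS p \<in> H"
  then show "\<forall>X. instS X p \<in> H"
    by (intro allI closed[of "[AllS p]"] nd.AllSE nd.Assm) auto
next
  assume "\<forall>X. instS X p \<in> H"
  then show "AllS p \<in> H"
    using decided[of "AllS p"] mem_Fls by (auto simp: decided_def mem_Imp)
qed

lemma mem_Refl: "Eq t t \<in> H"
  by (rule closed[of "[]"]) (auto intro: nd.Refl)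

lemma Subst: "Eq t u \<in> H \<Longrightarrow> instN t p \<in> H \<Longrightarrow> instN u p \<in> H"
  by (rule closed[of "[Eq t u, instN t p]"], simp, rule nd.Subst[of _ t u]) (simp_all add: nd.Assm)

lemma Subst':
  assumes "Eq t u \<in> H" "fsub (case_nat t Var) id p = q" "fsub (case_nat u Var) id p = r" "q \<in> H"
  shows "r \<in> H"
  using Subst[of t u p] assms by (simp add: instN_def)

lemma mem_Sym: "Eq t u \<in> H \<Longrightarrow> Eq u t \<in> H"
  by (rule Subst'[of t u "Eq (Var 0) (tshift t)", OF _ _ _ mem_Refl[of t]]) (auto simp: tsub_tsub)

lemma mem_Trans: "Eq t u \<in> H \<Longrightarrow> Eq u v \<in> H \<Longrightarrow> Eq t v \<in> H"
  by (rule Subst'[of u v "Eq (tshift t) (Var 0)" "Eq t u"]) (auto simp: tsub_tsub)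

lemma cong_Add:
  assumes "Eq t t' \<in> H" "Eq u u' \<in> H"
  shows "Eq (Add t u) (Add t' u') \<in> H"
proof -
  have "Eq (Add t u) (Add t' u) \<in> H"
    by (rule Subst'[of t t' "Eq (Add (tshift t) (tshift u)) (Add (Var 0) (tshift u))", OF assms(1) _ _ mem_Refl])
       (auto simp: tsub_tsub)
  then show ?thesis
    by (rule Subst'[of u u' "Eq (Add (tshift t) (tshift u)) (Add (tshift t') (Var 0))", OF assms(2), rotated 2])
       (auto simp: tsub_tsub)
qed

lemma cong_Mul:
  assumes "Eq t t' \<in> H" "Eq u u' \<in> H"
  shows "Eq (Mul t u) (Mul t' u') \<in> H"
proof -
  have "Eq (Mul t u) (Mul t' u) \<in> H"
    by (rule Subst'[of t t' "Eq (Mul (tshift t) (tshift u)) (Mul (Var 0) (tshift u))", OF assms(1) _ _ mem_Refl])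
       (auto simp: tsub_tsub)
  then show ?thesis
    by (rule Subst'[of u u' "Eq (Mul (tshift t) (tshift u)) (Mul (tshift t') (Var 0))", OF assms(2), rotated 2])
       (auto simp: tsub_tsub)
qed

lemma cong_Less:
  assumes "Eq t t' \<in> H" "Eq u u' \<in> H" "Less t u \<in> H"
  shows "Less t' u' \<in> H"
proof -
  have "Less t' u \<in> H"
    by (rule Subst'[of t t' "Less (Var 0) (tshift u)", OF assms(1) _ _ assms(3)])
       (auto simp: tsub_tsub)
  then show ?thesis
    by (rule Subst'[of u u' "Less (tshift t') (Var 0)", OF assms(2), rotated 2])
       (auto simp: tsub_tsub)
qed

lemma cong_Mem: "Eq t t' \<in> H \<Longrightarrow> Mem t X \<in> H \<Longrightarrow> Mem t' X \<in> H"
  by (rule Subst'[of t t' "Mem (Var 0) X" "Mem t X"]) auto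

text \<open>The elements stand for terms modulo provable equality. \<open>val\<close> is an
  arbitrary surjection with this kernel, which leaves the carrier open and later allows it to be
  \<open>nat\<close>.\<close>

lemma canonical_structure:
  fixes val :: "tm \<Rightarrow> 'a"
  assumes surj: "surj val" and val: "\<And>t u. val t = val u \<longleftrightarrow> Eq t u \<in> H"
  shows "\<exists>M :: 'a l2_structure. setsM M \<noteq> {} \<and> (\<forall>p\<in>H. fm_below 0 0 p \<longrightarrow> models M p)"
proof -
  define rep where "rep = inv val"
  have rep: "val (rep a) = a" for a using surj by (simp add: rep_def surj_f_inv_f)
  have rep': "Eq t (rep (val t)) \<in> H" "Eq (rep (val t)) t \<in> H" for t
    using val rep by metis+
  define S where "S X = {val t |t. Mem t X \<in> H}" for X
  define M where "M = \<lparr>zeroM = val Zero, oneM = val One,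
    addM = (\<lambda>a b. val (Add (rep a) (rep b))), mulM = (\<lambda>a b. val (Mul (rep a) (rep b))),
    lessM = (\<lambda>a b. Less (rep a) (rep b) \<in> H), setsM = range S\<rparr>"
  have ev: "teval M (\<lambda>i. val (\<sigma> i)) t = val (tsub \<sigma> t)" for \<sigma> t
    by (induction t) (auto simp: M_def val rep' cong_Add cong_Mul)
  have S: "val t \<in> S X \<longleftrightarrow> Mem t X \<in> H" for t X
    unfolding S_def using val cong_Mem mem_Sym by blast
  have L: "lessM M (val t) (val u) \<longleftrightarrow> Less t u \<in> H" for t u
    unfolding M_def using cong_Less rep' by simp blast
  \<comment> \<open>Stating the truth lemma for all substitutions lets the quantifier cases extend
    the substitution by a witness; for the identity alone the induction hypothesis would be too
    weak.\<close>
  have truth: "sat M (\<lambda>i. val (\<sigma> i)) (\<lambda>i. S (\<rho> i)) p \<longleftrightarrow> fsub \<sigma> \<rho> p \<in> H" for \<sigma> \<rho> p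
  proof (induction p arbitrary: \<sigma> \<rho>)
    case (AllN p)
    have 1: "case_nat (val t) (\<lambda>i. val (\<sigma> i)) = (\<lambda>i. val (case_nat t \<sigma> i))" for t
      by (auto simp: fun_eq_iff split: nat.split)
    have 2: "instN t (fsub (lift \<sigma>) \<rho> p) = fsub (case_nat t \<sigma>) \<rho> p" for t
      unfolding instN_def fsub_fsub
      by (rule arg_cong2[where f = "\<lambda>\<sigma> \<rho>. fsub \<sigma> \<rho> p"])
         (auto simp: fun_eq_iff tsub_tsub split: nat.split)
    have "sat M (\<lambda>i. val (\<sigma> i)) (\<lambda>i. S (\<rho> i)) (AllN p) \<longleftrightarrow>
        (\<forall>t. sat M (case_nat (val t) (\<lambda>i. val (\<sigma> i))) (\<lambda>i. S (\<rho> i)) p)"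
      using surj by (metis rep sat.simps(6))
    then show ?case by (simp add: 1 2 AllN.IH mem_AllN)
  next
    case (AllS p)
    have 1: "case_nat (S X) (\<lambda>i. S (\<rho> i)) = (\<lambda>i. S (case_nat X \<rho> i))" for X
      by (auto simp: fun_eq_iff split: nat.split)
    have 2: "instS X (fsub \<sigma> (liftS \<rho>) p) = fsub \<sigma> (case_nat X \<rho>) p" for X
      unfolding instS_def fsub_fsub
      by (rule arg_cong2[where f = "\<lambda>\<sigma> \<rho>. fsub \<sigma> \<rho> p"])
         (auto simp: fun_eq_iff split: nat.split)
    have "setsM M = range S" by (simp add: M_def)
    then show ?case by (simp add: 1 2 AllS.IH mem_AllS)
  qed (auto simp: ev val L S mem_Fls mem_Imp)
  have "sat M e E p" if "p \<in> H" "fm_below 0 0 p" "range E \<subseteq> setsM M" for e E p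
  proof -
    have "\<forall>i. \<exists>X. E i = S X" using that(3) by (auto simp: M_def)
    then obtain \<rho> where "\<forall>i. E i = S (\<rho> i)" by metis
    then have E: "E = (\<lambda>i. S (\<rho> i))" by auto
    have e: "e = (\<lambda>i. val (rep (e i)))" by (simp add: rep)
    have "fsub (\<lambda>i. rep (e i)) \<rho> p = fsub Var id p"
      by (rule fsub_cong[OF that(2)]) auto
    then have "fsub (\<lambda>i. rep (e i)) \<rho> p \<in> H" using that(1) by simp
    then show ?thesis unfolding E by (subst e, subst truth)
  qed
  then have "\<forall>p\<in>H. fm_below 0 0 p \<longrightarrow> models M p" unfolding models_def by blast
  moreover have "setsM M \<noteq> {}" by (simp add: M_def)
  ultimately show ?thesis by blast
qed

text \<open>The successor acts injectively on the classes of terms and misses the class of zero,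
  which is impossible on a finite set.\<close>

lemma infinite_classes:
  assumes "basic_axioms \<subseteq> H"
  shows "infinite (range (\<lambda>t. {u. Eq t u \<in> H}))"
proof
  let ?c = "\<lambda>t. {u. Eq t u \<in> H}"
  assume fin: "finite (range ?c)"
  have c: "?c t = ?c u \<longleftrightarrow> Eq t u \<in> H" for t u using mem_Refl mem_Sym mem_Trans by blast
  define f where "f C = ?c (Add (SOME t. C = ?c t) One)" for C
  have f: "f (?c t) = ?c (Add t One)" for t
  proof -
    have "?c t = ?c (SOME u. ?c t = ?c u)" by (rule someI[of _ t]) simp
    then show ?thesis unfolding f_def c using cong_Add mem_Refl mem_Sym by blast
  qed
  have "AllN (Neg (Eq (Add (Var 0) One) Zero)) \<in> H"
    "AllN (AllN (Imp (Eq (Add (Var 1) One) (Add (Var 0) One)) (Eq (Var 1) (Var 0)))) \<in> H"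
    using assms unfolding basic_axioms_def
    by (auto simp: sentence_def allN'_def neg'_def imp'_def eq'_def add'_def one'_def zero'_def)
  then have *: "instN t (Neg (Eq (Add (Var 0) One) Zero)) \<in> H"
    "instN t (AllN (Imp (Eq (Add (Var 1) One) (Add (Var 0) One)) (Eq (Var 1) (Var 0)))) \<in> H" for t
    using mem_AllN by blast+
  have 0: "Eq (Add t One) Zero \<notin> H" for t
    using *(1)[of t] mem_Fls by (simp add: instN_def mem_Imp)
  have 1: "Eq t u \<in> H" if "Eq (Add t One) (Add u One) \<in> H" for t u
    using *(2)[of t] that by (simp add: instN_def mem_AllN mem_Imp tsub_tsub)
  have "inj_on f (range ?c)"
  proof (rule inj_onI, elim imageE, hypsubst)
    show "?c t = ?c u" if "f (?c t) = f (?c u)" for t u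
      using that 1 unfolding f c by blast
  qed
  moreover have "f ` range ?c \<subseteq> range ?c" using f by auto
  ultimately have "f ` range ?c = range ?c" by (intro endo_inj_surj[OF fin])
  then have "?c Zero \<in> f ` range ?c" by blast
  then obtain t where "?c Zero = f (?c t)" by blast
  then show False using 0 mem_Sym unfolding f c by blast
qed

end

text \<open>Models on \<open>nat\<close> suffice: the language is countable and the basic axioms
  force infinitely many classes of terms. One fixed carrier is needed because the hypothesis cannot
  quantify over types.\<close>

theorem completeness:
  assumes "\<And>M :: nat l2_structure. setsM M \<noteq> {} \<Longrightarrow> (\<And>q. q \<in> T \<Longrightarrow> models M q) \<Longrightarrow> models M p"
    and T: "\<forall>q\<in>T. fm_below 0 0 q" "basic_axioms \<subseteq> T" and p: "fm_below 0 0 p"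
  shows "T \<turnstile> p"
proof (rule provable_Raa, rule ccontr)
  assume "consistent (insert (Neg p) T)"
  moreover have "\<forall>q\<in>insert (Neg p) T. fm_below 0 0 q" using T p by simp
  ultimately obtain H where H: "insert (Neg p) T \<subseteq> H" "consistent H" "\<And>p. decided p H"
    using henkin_extension[of "insert (Neg p) T"] by metis
  then interpret henkin H by unfold_locales
  let ?C = "range (\<lambda>t. {u. Eq t u \<in> H})"
  have "countable ?C" by simp
  moreover have "infinite ?C" using infinite_classes H(1) T(2) by blast
  ultimately obtain g :: "tm set \<Rightarrow> nat" where g: "bij_betw g ?C UNIV"
    using countableE_infinite by blast
  have "\<exists>M :: nat l2_structure. setsM M \<noteq> {} \<and> (\<forall>p\<in>H. fm_below 0 0 p \<longrightarrow> models M p)"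
  proof (rule canonical_structure)
    show "surj (\<lambda>t. g {u. Eq t u \<in> H})" using g by (simp add: bij_betw_def image_image)
    show "g {v. Eq t v \<in> H} = g {v. Eq u v \<in> H} \<longleftrightarrow> Eq t u \<in> H" for t u
    proof -
      have "inj_on g ?C" using g by (simp add: bij_betw_def)
      then have "g {v. Eq t v \<in> H} = g {v. Eq u v \<in> H} \<longleftrightarrow> {v. Eq t v \<in> H} = {v. Eq u v \<in> H}"
        by (rule inj_on_eq_iff) auto
      also have "\<dots> \<longleftrightarrow> Eq t u \<in> H" using mem_Refl mem_Sym mem_Trans by blast
      finally show ?thesis .
    qed
  qed
  then obtain M :: "nat l2_structure" where
    M: "setsM M \<noteq> {}" "\<forall>p\<in>H. fm_below 0 0 p \<longrightarrow> models M p" by blast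
  obtain X where X: "X \<in> setsM M" using M(1) by blast
  have "models M q" if "q \<in> T" for q
    using M(2) H(1) T(1) that by blast
  then have "models M p" using assms(1)[of M] M(1) by blast
  moreover have "Neg p \<in> H" "fm_below 0 0 (Neg p)" using H(1) p by auto
  then have "models M (Neg p)" using M(2) by blast
  ultimately have "sat M (\<lambda>_. 0) (\<lambda>_. X) p" "sat M (\<lambda>_. 0) (\<lambda>_. X) (Neg p)"
    using X unfolding models_def by auto
  then show False by simp
qed

section \<open>Definability in models\<close>

text \<open>Here the carrier is a whole type, so the operations can be the overloaded ones and
  arithmetic in a model can use the general theory of ordered semirings.\<close>

class l2 = zero + one + plus + times + minus + ord +
  fixes sets :: "'a set set"
begin

definition M0 :: "'a l2_structure" where
  "M0 = \<lparr>zeroM = 0, oneM = 1, addM = (+), mulM = (*), lessM = (<), setsM = sets\<rparr>"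

end

lemma M0_sel [simp]:
  "zeroM M0 = 0" "oneM M0 = 1" "addM M0 = (+)" "mulM M0 = (*)" "lessM M0 = (<)" "setsM M0 = sets"
  by (simp_all add: M0_def)

text \<open>Subtraction is determined by addition; it is present only because \<open>linordered_semidom\<close>
demands it.\<close>

class rca0 = l2 +
  assumes sets_nonempty: "sets \<noteq> {}"
    and models_RCA0: "p \<in> RCA0 \<Longrightarrow> models M0 p"
    and minus_rca0: "a - b = (if \<exists>c. a = b + c then THE c. a = b + c else 0)"
    and less_eq_rca0: "a \<le> b \<longleftrightarrow> a < b \<or> a = b"

lemma case_nat_eta: "case_nat (e 0) (\<lambda>i. e (Suc i)) = e"
  by (auto simp: fun_eq_iff split: nat.split)

section \<open>Closures and axiom schemes in a structure\<close>

lemma models_AllN [simp]: "models M (AllN p) \<longleftrightarrow> models M p"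
proof
  show "models M p" if "models M (AllN p)"
    unfolding models_def
  proof (intro allI impI)
    fix e and E :: "nat \<Rightarrow> 'a set" assume "range E \<subseteq> setsM M"
    then have "sat M (\<lambda>i. e (Suc i)) E (AllN p)" using that unfolding models_def by blast
    then have "sat M (case_nat (e 0) (\<lambda>i. e (Suc i))) E p" by simp
    then show "sat M e E p" by (simp add: case_nat_eta)
  qed
qed (simp add: models_def)

lemma models_AllS [simp]: "models M (AllS p) \<longleftrightarrow> models M p"
proof
  assume p: "models M (AllS p)"
  show "models M p"
    unfolding models_def
  proof (intro allI impI)
    fix e and E :: "nat \<Rightarrow> 'a set"
    assume E: "range E \<subseteq> setsM M"
    then have "range (\<lambda>i. E (Suc i)) \<subseteq> setsM M" by auto
    then have "sat M e (\<lambda>i. E (Suc i)) (AllS p)" using p by (simp add: models_def)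
    then have "sat M e (case_nat (E 0) (\<lambda>i. E (Suc i))) p" using E by auto
    then show "sat M e E p" by (simp add: case_nat_eta)
  qed
next
  assume p: "models M p"
  show "models M (AllS p)"
    unfolding models_def sat.simps
  proof (intro allI impI ballI)
    fix e and E :: "nat \<Rightarrow> 'a set" and X
    assume "range E \<subseteq> setsM M" "X \<in> setsM M"
    then have "case_nat X E i \<in> setsM M" for i by (cases i) auto
    then have "range (case_nat X E) \<subseteq> setsM M" by auto
    then show "sat M e (case_nat X E) p" using p unfolding models_def by blast
  qed
qed

lemma models_closures: "q \<in> closures p \<Longrightarrow> models M q \<longleftrightarrow> models M p"
proof -
  have "models M ((AllN ^^ m) r) = models M r" "models M ((AllS ^^ m) r) = models M r" for m r
    by (induction m) auto
  then show "q \<in> closures p \<Longrightarrow> ?thesis" unfolding closures_def by auto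
qed

text \<open>Instances of the schemes enter the base theory only through their closures, so each
  instance needs at least one.\<close>

lemma closures_nonempty: "\<exists>q. q \<in> closures p"
  using fm_below_exists[of p] unfolding closures_def by blast

lemma sat_instN: "sat M e E (instN t p) = sat M (case_nat (teval M e t) e) E p"
  unfolding instN_def sat_fsub
  by (rule arg_cong2[where f = "\<lambda>e E. sat M e E p"]) (auto simp: fun_eq_iff split: nat.split)

lemma sat_shiftS [simp]: "sat M e (case_nat X E) (shiftS p) = sat M e E p"
  unfolding shiftS_def sat_fsub by simp

lemma sat_induction_axiom:
  "sat M e E (induction_axiom p) \<longleftrightarrow>
    (sat M (case_nat (zeroM M) e) E p \<longrightarrow>
     (\<forall>x. sat M (case_nat x e) E p \<longrightarrow> sat M (case_nat (addM M x (oneM M)) e) E p) \<longrightarrow>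
     (\<forall>x. sat M (case_nat x e) E p))"
proof -
  have "(\<lambda>i. teval M (case_nat x e) (case_nat (Add (Var 0) One) (\<lambda>i. Var (Suc i)) i)) =
      case_nat (addM M x (oneM M)) e" for x
    by (auto simp: fun_eq_iff split: nat.split)
  then show ?thesis by (auto simp: induction_axiom_def sat_instN sat_fsub)
qed

lemma sat_comprehension_axiom:
  "sat M e E (comprehension_axiom p q) \<longleftrightarrow>
    ((\<forall>x. sat M (case_nat x e) E p \<longleftrightarrow> sat M (case_nat x e) E q) \<longrightarrow>
     (\<exists>X\<in>setsM M. \<forall>x. x \<in> X \<longleftrightarrow> sat M (case_nat x e) E p))"
  by (auto simp: comprehension_axiom_def)

lemma Delta00_fsub: "Delta00 p \<Longrightarrow> Delta00 (fsub \<sigma> \<rho> p)"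
proof (induction arbitrary: \<sigma> \<rho> rule: Delta00.induct)
  case (6 p t)
  have "tsub (lift \<sigma>) (tshift t) = tshift (tsub \<sigma> t)" by (simp add: tsub_tsub)
  then show ?case using 6 by (simp add: Delta00.intros)
qed (auto intro: Delta00.intros)

text \<open>A predicate of \<open>k\<close> numbers is evaluated in an environment whose first \<open>k\<close> entries are its
arguments and whose further entries \<open>c\<close> are parameters. Rules for the quantifiers then
need no renaming, since \<open>case_nat x\<close> turns such an environment into one for \<open>k + 1\<close> arguments.\<close>

abbreviation params :: "nat \<Rightarrow> (nat \<Rightarrow> 'a) \<Rightarrow> (nat \<Rightarrow> 'a) \<Rightarrow> nat \<Rightarrow> 'a" where
  "params k c e \<equiv> \<lambda>i. if i < k then e i else c (i - k)"

lemma case_nat_params: "case_nat x (params k c e) = params (Suc k) c (case_nat x e)"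
  by (auto simp: fun_eq_iff split: nat.split)

definition tm_in :: "(nat \<Rightarrow> 'a::rca0) \<Rightarrow> nat \<Rightarrow> ((nat \<Rightarrow> 'a) \<Rightarrow> 'a) \<Rightarrow> bool" where
  "tm_in c k T \<longleftrightarrow> (\<exists>t. \<forall>e. T e = teval M0 (params k c e) t)"

text \<open>A shallow counterpart of bounded formulas: \<open>P\<close> is an ordinary HOL
  predicate, and that it belongs to the class is derived from closure rules rather than by
  exhibiting a formula each time.\<close>

definition d0_in ::
  "(nat \<Rightarrow> 'a::rca0) \<Rightarrow> (nat \<Rightarrow> 'a set) \<Rightarrow> nat \<Rightarrow> ((nat \<Rightarrow> 'a) \<Rightarrow> bool) \<Rightarrow> bool" where
  "d0_in c C k P \<longleftrightarrow> (\<exists>p. Delta00 p \<and> (\<forall>e. P e = sat M0 (params k c e) C p))"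

definition tmd :: "nat \<Rightarrow> ((nat \<Rightarrow> 'a::rca0) \<Rightarrow> 'a) \<Rightarrow> bool" where
  "tmd k T \<longleftrightarrow> (\<exists>c. tm_in c k T)"

definition d0 :: "nat \<Rightarrow> ((nat \<Rightarrow> 'a::rca0) \<Rightarrow> bool) \<Rightarrow> bool" where
  "d0 k P \<longleftrightarrow> (\<exists>c C. range C \<subseteq> sets \<and> d0_in c C k P)"

lemma tm_in_params:
  assumes "tm_in c k T" "\<And>i. c i = c' (r i)"
  shows "tm_in c' k T"
proof -
  obtain t where t: "\<forall>e. T e = teval M0 (params k c e) t" using assms(1) unfolding tm_in_def by blast
  have "T e = teval M0 (params k c' e) (tsub (\<lambda>i. Var (if i < k then i else k + r (i - k))) t)" for e
    unfolding t[rule_format] teval_tsub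
    by (rule arg_cong[where f = "\<lambda>e. teval M0 e t"]) (auto simp: assms(2))
  then show ?thesis unfolding tm_in_def by blast
qed

lemma d0_in_rename:
  assumes "d0_in c C k P" "\<And>i. c i = c' (r i)" "\<And>i. C i = C' (s i)" "\<And>i. i < k \<Longrightarrow> f i < l"
  shows "d0_in c' C' l (\<lambda>e. P (\<lambda>i. e (f i)))"
proof -
  obtain p where p: "Delta00 p" "\<forall>e. P e = sat M0 (params k c e) C p"
    using assms(1) unfolding d0_in_def by blast
  have "P (\<lambda>i. e (f i)) =
      sat M0 (params l c' e) C' (fsub (\<lambda>i. Var (if i < k then f i else l + r (i - k))) s p)" for e
    unfolding p(2)[rule_format] sat_fsub
    by (rule arg_cong2[where f = "\<lambda>e E. sat M0 e E p"]) (auto simp: assms(2-4))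
  then show ?thesis unfolding d0_in_def using Delta00_fsub[OF p(1)] by blast
qed

lemma d0_rename:
  assumes "d0 k P" "\<And>i. i < k \<Longrightarrow> f i < l"
  shows "d0 l (\<lambda>e. P (\<lambda>i. e (f i)))"
proof -
  obtain c C where "range C \<subseteq> sets" "d0_in c C k P" using assms(1) unfolding d0_def by blast
  then show ?thesis
    unfolding d0_def using d0_in_rename[of c C k P c "\<lambda>i. i" C "\<lambda>i. i" f l] assms(2) by blast
qed

text \<open>Two formulas can be joined only if they read the same parameters; interleaving two
  parameter sequences provides a common one.\<close>

abbreviation merge :: "(nat \<Rightarrow> 'b) \<Rightarrow> (nat \<Rightarrow> 'b) \<Rightarrow> nat \<Rightarrow> 'b" where
  "merge c c' \<equiv> \<lambda>i. if even i then c (i div 2) else c' (i div 2)"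

lemma range_merge: "range C \<subseteq> S \<Longrightarrow> range C' \<subseteq> S \<Longrightarrow> range (merge C C') \<subseteq> S"
  by auto

lemma tm_in_merge:
  "tm_in c k T \<Longrightarrow> tm_in (merge c c') k T" "tm_in c' k T \<Longrightarrow> tm_in (merge c c') k T"
  by (erule tm_in_params[where r = "\<lambda>i. 2 * i"], simp)
     (erule tm_in_params[where r = "\<lambda>i. Suc (2 * i)"], simp)

lemma d0_in_merge:
  "d0_in c C k P \<Longrightarrow> d0_in (merge c c') (merge C C') k P"
  "d0_in c' C' k P \<Longrightarrow> d0_in (merge c c') (merge C C') k P"
  using d0_in_rename[of c C k P "merge c c'" "\<lambda>i. 2 * i" "merge C C'" "\<lambda>i. 2 * i" "\<lambda>i. i" k]
    d0_in_rename[of c' C' k P "merge c c'" "\<lambda>i. Suc (2 * i)" "merge C C'" "\<lambda>i. Suc (2 * i)" "\<lambda>i. i" k]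
  by auto

lemma tmd_common:
  assumes "tmd k T" "tmd l U"
  obtains c where "tm_in c k T" "tm_in c l U"
proof -
  obtain c c' where "tm_in c k T" "tm_in c' l U" using assms unfolding tmd_def by blast
  then have "tm_in (merge c c') k T" "tm_in (merge c c') l U" by (simp_all only: tm_in_merge)
  then show ?thesis by (rule that)
qed

lemma d0_common:
  assumes "d0 k P" "d0 l Q"
  obtains c C where "range C \<subseteq> sets" "d0_in c C k P" "d0_in c C l Q"
proof -
  obtain c C where "range C \<subseteq> sets" "d0_in c C k P" using assms(1) unfolding d0_def by blast
  moreover obtain c' C' where "range C' \<subseteq> sets" "d0_in c' C' l Q"
    using assms(2) unfolding d0_def by blast
  ultimately have "d0_in (merge c c') (merge C C') k P" "d0_in (merge c c') (merge C C') l Q"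
    "range (merge C C') \<subseteq> sets" by (simp_all only: d0_in_merge range_merge)
  then show ?thesis by (intro that)
qed

section \<open>Closure properties of bounded definability\<close>

named_theorems d0_intros

lemma tmd_const [d0_intros]: "tmd k (\<lambda>e. a)"
  unfolding tmd_def tm_in_def by (intro exI[of _ "\<lambda>_. a"] exI[of _ "Var k"]) simp

lemma tmd_var [d0_intros]: "i < k \<Longrightarrow> tmd k (\<lambda>e. e i)"
  unfolding tmd_def tm_in_def by (intro exI[of _ "Var i"] exI) simp

lemma tmd_add [d0_intros]: "tmd k T \<Longrightarrow> tmd k U \<Longrightarrow> tmd k (\<lambda>e. T e + U e)"
proof (erule (1) tmd_common)
  fix c assume "tm_in c k T" "tm_in c k U"
  then obtain t u where "\<forall>e. T e = teval M0 (params k c e) t" "\<forall>e. U e = teval M0 (params k c e) u"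
    unfolding tm_in_def by blast
  then show ?thesis unfolding tmd_def tm_in_def by (intro exI[of _ c] exI[of _ "Add t u"]) simp
qed

lemma tmd_mul [d0_intros]: "tmd k T \<Longrightarrow> tmd k U \<Longrightarrow> tmd k (\<lambda>e. T e * U e)"
proof (erule (1) tmd_common)
  fix c assume "tm_in c k T" "tm_in c k U"
  then obtain t u where "\<forall>e. T e = teval M0 (params k c e) t" "\<forall>e. U e = teval M0 (params k c e) u"
    unfolding tm_in_def by blast
  then show ?thesis unfolding tmd_def tm_in_def by (intro exI[of _ c] exI[of _ "Mul t u"]) simp
qed

lemma sets_exist: "\<exists>C :: nat \<Rightarrow> 'a::rca0 set. range C \<subseteq> sets"
proof -
  obtain X :: "'a set" where "X \<in> sets" using sets_nonempty[where 'a = 'a] by blast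
  then show ?thesis by (intro exI[of _ "\<lambda>_. X"]) auto
qed

lemma d0_eq [d0_intros]: "tmd k T \<Longrightarrow> tmd k U \<Longrightarrow> d0 k (\<lambda>e. T e = U e)"
proof (erule (1) tmd_common)
  fix c assume "tm_in c k T" "tm_in c k U"
  then obtain t u where "\<forall>e. T e = teval M0 (params k c e) t" "\<forall>e. U e = teval M0 (params k c e) u"
    unfolding tm_in_def by blast
  then have "d0_in c C k (\<lambda>e. T e = U e)" for C
    unfolding d0_in_def by (intro exI[of _ "Eq t u"]) (auto intro: Delta00.intros)
  then show ?thesis unfolding d0_def using sets_exist by blast
qed

lemma d0_less [d0_intros]: "tmd k T \<Longrightarrow> tmd k U \<Longrightarrow> d0 k (\<lambda>e. T e < U e)"
proof (erule (1) tmd_common)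
  fix c assume "tm_in c k T" "tm_in c k U"
  then obtain t u where "\<forall>e. T e = teval M0 (params k c e) t" "\<forall>e. U e = teval M0 (params k c e) u"
    unfolding tm_in_def by blast
  then have "d0_in c C k (\<lambda>e. T e < U e)" for C
    unfolding d0_in_def by (intro exI[of _ "Less t u"]) (auto intro: Delta00.intros)
  then show ?thesis unfolding d0_def using sets_exist by blast
qed

lemma d0_mem [d0_intros]: "tmd k T \<Longrightarrow> X \<in> sets \<Longrightarrow> d0 k (\<lambda>e. T e \<in> X)"
  unfolding tmd_def
proof (elim exE)
  fix c assume "tm_in c k T" "X \<in> sets"
  then obtain t where "\<forall>e. T e = teval M0 (params k c e) t" unfolding tm_in_def by blast
  then have "d0_in c (\<lambda>_. X) k (\<lambda>e. T e \<in> X)"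
    unfolding d0_in_def by (intro exI[of _ "Mem t 0"]) (auto intro: Delta00.intros)
  then show ?thesis unfolding d0_def
    using \<open>X \<in> sets\<close> by (intro exI[of _ c] exI[of _ "\<lambda>_. X"]) auto
qed

lemma d0_imp [d0_intros]: "d0 k P \<Longrightarrow> d0 k Q \<Longrightarrow> d0 k (\<lambda>e. P e \<longrightarrow> Q e)"
proof (erule (1) d0_common)
  fix c C assume C: "range C \<subseteq> sets" and "d0_in c C k P" "d0_in c C k Q"
  then obtain p q where "Delta00 p" "\<forall>e. P e = sat M0 (params k c e) C p"
    "Delta00 q" "\<forall>e. Q e = sat M0 (params k c e) C q"
    unfolding d0_in_def by blast
  then have "d0_in c C k (\<lambda>e. P e \<longrightarrow> Q e)"
    unfolding d0_in_def by (intro exI[of _ "Imp p q"]) (auto intro: Delta00.intros)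
  then show ?thesis unfolding d0_def using C by blast
qed

lemma d0_False: "d0 k (\<lambda>e :: nat \<Rightarrow> 'a::rca0. False)"
proof -
  have "d0_in (c :: nat \<Rightarrow> 'a) C k (\<lambda>e. False)" for c C
    unfolding d0_in_def by (intro exI[of _ Fls]) (auto intro: Delta00.intros)
  then show ?thesis unfolding d0_def using sets_exist by blast
qed

lemma d0_not [d0_intros]: "d0 k P \<Longrightarrow> d0 k (\<lambda>e. \<not> P e)"
  using d0_imp[OF _ d0_False] by simp

lemma d0_const [d0_intros]: "d0 k (\<lambda>e. b)"
  using d0_False d0_not[OF d0_False] by (cases b) simp_all

lemma d0_disj [d0_intros]: "d0 k P \<Longrightarrow> d0 k Q \<Longrightarrow> d0 k (\<lambda>e. P e \<or> Q e)"
  using d0_imp[OF d0_not] by (simp add: disj_imp)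

lemma d0_conj [d0_intros]: "d0 k P \<Longrightarrow> d0 k Q \<Longrightarrow> d0 k (\<lambda>e. P e \<and> Q e)"
  using d0_not[OF d0_disj[OF d0_not d0_not]] by simp

lemma d0_iff [d0_intros]: "d0 k P \<Longrightarrow> d0 k Q \<Longrightarrow> d0 k (\<lambda>e. P e \<longleftrightarrow> Q e)"
  using d0_conj[OF d0_imp d0_imp] by (simp add: iff_conv_conj_imp)

text \<open>The bound variable becomes argument 0 and the former arguments move up by one, in step
  with the de Bruijn indices.\<close>

lemma d0_all [d0_intros]:
  assumes "tmd k T" "d0 (Suc k) (\<lambda>e. Q (e 0) (\<lambda>i. e (Suc i)))"
  shows "d0 k (\<lambda>e. \<forall>x. x < T e \<longrightarrow> Q x e)"
proof -
  obtain c c' C where C: "range C \<subseteq> sets" and "tm_in c' k T"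
    and "d0_in c C (Suc k) (\<lambda>e. Q (e 0) (\<lambda>i. e (Suc i)))"
    using assms unfolding d0_def tmd_def by blast
  then have "tm_in (merge c c') k T" "d0_in (merge c c') (merge C C) (Suc k) (\<lambda>e. Q (e 0) (\<lambda>i. e (Suc i)))"
    by (simp_all only: tm_in_merge d0_in_merge)
  then obtain t p where t: "\<And>e. T e = teval M0 (params k (merge c c') e) t" and p: "Delta00 p"
    "\<And>e. Q (e 0) (\<lambda>i. e (Suc i)) = sat M0 (params (Suc k) (merge c c') e) (merge C C) p"
    unfolding d0_in_def tm_in_def by blast
  have q: "Q x e = sat M0 (case_nat x (params k (merge c c') e)) (merge C C) p" for x e
    by (subst case_nat_params) (use p(2)[of "case_nat x e"] in simp)
  have "d0_in (merge c c') (merge C C) k (\<lambda>e. \<forall>x. x < T e \<longrightarrow> Q x e)"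
    unfolding d0_in_def
    by (intro exI[of _ "AllN (Imp (Less (Var 0) (tshift t)) p)"]) (auto intro: Delta00.intros p simp: t q)
  then show ?thesis unfolding d0_def using range_merge[OF C C] by blast
qed

lemma d0_ex [d0_intros]:
  assumes "tmd k T" "d0 (Suc k) (\<lambda>e. Q (e 0) (\<lambda>i. e (Suc i)))"
  shows "d0 k (\<lambda>e. \<exists>x. x < T e \<and> Q x e)"
  using d0_not[OF d0_all[OF assms(1) d0_not[OF assms(2)]]] by simp

lemma d0_le [d0_intros]: "tmd k T \<Longrightarrow> tmd k U \<Longrightarrow> d0 k (\<lambda>e. T e \<le> U e)"
  unfolding less_eq_rca0 by (intro d0_intros)

section \<open>Sigma-1 predicates, induction and comprehension\<close>

definition s1 :: "nat \<Rightarrow> ((nat \<Rightarrow> 'a::rca0) \<Rightarrow> bool) \<Rightarrow> bool" where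
  "s1 k P \<longleftrightarrow> (\<exists>Q. d0 (Suc k) (\<lambda>e. Q (e 0) (\<lambda>i. e (Suc i))) \<and> (\<forall>e. P e = (\<exists>x. Q x e)))"

lemma s1_ex_d0: "d0 (Suc k) (\<lambda>e. Q (e 0) (\<lambda>i. e (Suc i))) \<Longrightarrow> s1 k (\<lambda>e. \<exists>x. Q x e)"
  unfolding s1_def by blast

lemma s1_d0: "d0 k P \<Longrightarrow> s1 k P"
  unfolding s1_def using d0_rename[of k P Suc "Suc k"] by (intro exI[of _ "\<lambda>x. P"]) auto

lemma s1_unary:
  assumes "s1 (Suc 0) (\<lambda>e. P (e 0))"
  obtains Q where "d0 (Suc (Suc 0)) (\<lambda>e. Q (e 0) (e (Suc 0)))" "\<And>x. P x \<longleftrightarrow> (\<exists>v. Q v x)"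
proof -
  obtain Q where Q: "d0 (Suc (Suc 0)) (\<lambda>e. Q (e 0) (\<lambda>i. e (Suc i)))"
    "\<And>e. P (e 0) = (\<exists>x. Q x e)"
    using assms unfolding s1_def by blast
  show ?thesis
  proof (rule that[of "\<lambda>v x. Q v (\<lambda>_. x)"])
    show "d0 (Suc (Suc 0)) (\<lambda>e. Q (e 0) (\<lambda>_. e (Suc 0)))"
      using d0_rename[OF Q(1), of "case_nat 0 (\<lambda>_. Suc 0)" "Suc (Suc 0)"] by (auto split: nat.split)
    show "P x \<longleftrightarrow> (\<exists>v. Q v (\<lambda>_. x))" for x using Q(2)[of "\<lambda>_. x"] by simp
  qed
qed

lemma d0_in_binary:
  assumes "d0_in c C (Suc (Suc 0)) (\<lambda>e. Q (e 0) (e (Suc 0)))"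
  obtains p where "Delta00 p" "\<And>v x. Q v x \<longleftrightarrow> sat M0 (case_nat v (case_nat x c)) C p"
proof -
  obtain p where p: "Delta00 p"
    "\<And>e. Q (e 0) (e (Suc 0)) = sat M0 (params (Suc (Suc 0)) c e) C p"
    using assms unfolding d0_in_def by blast
  have "params (Suc (Suc 0)) c (case_nat v (\<lambda>_. x)) = case_nat v (case_nat x c)" for v x
    by (auto simp: fun_eq_iff less_Suc_eq split: nat.split)
  then show ?thesis using p(2)[of "case_nat v (\<lambda>_. x)" for v x] p(1) by (intro that[of p]) simp_all
qed

text \<open>The formula behind \<open>P\<close> is recovered together with its parameters; some
  closure of its induction axiom belongs to the base theory, and evaluating that axiom at the
  parameters gives the claim.\<close>

theorem sigma1_induct:
  assumes P: "s1 (Suc 0) (\<lambda>e. P (e 0))" and "P 0" "\<And>x. P x \<Longrightarrow> P (x + 1)"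
  shows "P (x :: 'a::rca0)"
proof -
  obtain Q where Q: "d0 (Suc (Suc 0)) (\<lambda>e. Q (e 0) (e (Suc 0)))" "\<And>x. P x \<longleftrightarrow> (\<exists>v. Q v x)"
    using s1_unary[OF P] by blast
  obtain c C where C: "range C \<subseteq> sets" "d0_in c C (Suc (Suc 0)) (\<lambda>e. Q (e 0) (e (Suc 0)))"
    using Q(1) unfolding d0_def by blast
  obtain p where p: "Delta00 p" "\<And>v x. Q v x \<longleftrightarrow> sat M0 (case_nat v (case_nat x c)) C p"
    using d0_in_binary[OF C(2)] by blast
  obtain q where q: "q \<in> closures (induction_axiom (ExN p))" using closures_nonempty by blast
  have "Sigma01 (ExN p)" using p(1) unfolding Sigma01_def by blast
  then have "q \<in> RCA0" using q unfolding RCA0_def by blast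
  then have "models (M0 :: 'a l2_structure) q" by (rule models_RCA0)
  then have "models (M0 :: 'a l2_structure) (induction_axiom (ExN p))" by (simp only: models_closures[OF q])
  then have "sat M0 c C (induction_axiom (ExN p))"
    using C(1) by (simp add: models_def)
  moreover have "sat M0 (case_nat x c) C (ExN p) \<longleftrightarrow> P x" for x by (simp add: Q(2) p(2))
  ultimately have "P 0 \<longrightarrow> (\<forall>x. P x \<longrightarrow> P (x + 1)) \<longrightarrow> (\<forall>x. P x)"
    by (simp only: sat_induction_axiom M0_sel)
  then show ?thesis using assms(2,3) by blast
qed

text \<open>The Pi-1 form demanded by the axiom is the negated Sigma-1 form of the complement; both
  forms are brought to common parameters first.\<close>

theorem delta1_comprehension:
  assumes P: "s1 (Suc 0) (\<lambda>e. P (e 0))" and P': "s1 (Suc 0) (\<lambda>e. \<not> P (e 0))"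
  shows "{x :: 'a::rca0. P x} \<in> sets"
proof -
  obtain Q where Q: "d0 (Suc (Suc 0)) (\<lambda>e. Q (e 0) (e (Suc 0)))" "\<And>x. P x \<longleftrightarrow> (\<exists>v. Q v x)"
    using s1_unary[OF P] by blast
  obtain R where R: "d0 (Suc (Suc 0)) (\<lambda>e. R (e 0) (e (Suc 0)))" "\<And>x. \<not> P x \<longleftrightarrow> (\<exists>v. R v x)"
    using s1_unary[OF P'] by blast
  obtain c C where C: "range C \<subseteq> sets" "d0_in c C (Suc (Suc 0)) (\<lambda>e. Q (e 0) (e (Suc 0)))"
    "d0_in c C (Suc (Suc 0)) (\<lambda>e. R (e 0) (e (Suc 0)))"
    using d0_common[OF Q(1) R(1)] by blast
  obtain p where p: "Delta00 p" "\<And>v x. Q v x \<longleftrightarrow> sat M0 (case_nat v (case_nat x c)) C p"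
    using d0_in_binary[OF C(2)] by blast
  obtain r where r: "Delta00 r" "\<And>v x. R v x \<longleftrightarrow> sat M0 (case_nat v (case_nat x c)) C r"
    using d0_in_binary[OF C(3)] by blast
  let ?A = "comprehension_axiom (ExN p) (AllN (Neg r))"
  obtain q where q: "q \<in> closures ?A" using closures_nonempty by blast
  have "Sigma01 (ExN p)" using p(1) unfolding Sigma01_def by blast
  moreover have "Pi01 (AllN (Neg r))" using r(1) unfolding Pi01_def by (blast intro: Delta00.intros)
  ultimately have "q \<in> RCA0" using q unfolding RCA0_def by blast
  then have "models (M0 :: 'a l2_structure) q" by (rule models_RCA0)
  then have "models (M0 :: 'a l2_structure) ?A" by (simp only: models_closures[OF q])
  then have "sat M0 c C ?A"
    using C(1) by (simp add: models_def)
  moreover have "P x \<longleftrightarrow> sat M0 (case_nat x c) C (ExN p)" for x by (simp add: Q(2) p(2))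
  moreover have "P x \<longleftrightarrow> sat M0 (case_nat x c) C (AllN (Neg r))" for x
    using R(2)[of x] by (auto simp: r(2))
  ultimately obtain X where "X \<in> sets" "\<forall>x. x \<in> X \<longleftrightarrow> P x"
    unfolding sat_comprehension_axiom by auto
  then show ?thesis by (metis Collect_mem_eq Collect_cong)
qed

lemma delta0_comprehension: "d0 (Suc 0) (\<lambda>e. P (e 0)) \<Longrightarrow> {x. P x} \<in> sets"
  by (intro delta1_comprehension s1_d0 d0_not)

lemma delta0_induct:
  "d0 (Suc 0) (\<lambda>e. P (e 0)) \<Longrightarrow> P 0 \<Longrightarrow> (\<And>x. P x \<Longrightarrow> P (x + 1)) \<Longrightarrow> P x"
  using sigma1_induct[of P x] s1_d0 by blast

section \<open>Arithmetic in models\<close>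

lemma rca0_axioms:
  fixes a b :: "'a::rca0"
  shows add_1_neq_0: "a + 1 \<noteq> 0" and add_1_inject: "a + 1 = b + 1 \<Longrightarrow> a = b"
    and add_0_rca0: "a + 0 = a" and add_add_1: "a + (b + 1) = a + b + 1"
    and mult_0_rca0: "a * 0 = 0" and mult_add_1: "a * (b + 1) = a * b + a"
    and not_less_0_rca0: "\<not> a < 0" and less_add_1: "a < b + 1 \<longleftrightarrow> a < b \<or> a = b"
proof -
  obtain E :: "nat \<Rightarrow> 'a set" where E: "range E \<subseteq> sets" using sets_exist by blast
  have "\<forall>p\<in>basic_axioms. sat M0 (\<lambda>_. 0) E p"
    using models_RCA0[where 'a = 'a] E unfolding RCA0_def models_def by simp
  then have *: "\<forall>a :: 'a. a + 1 \<noteq> 0" "\<forall>a b :: 'a. a + 1 = b + 1 \<longrightarrow> a = b" "\<forall>a :: 'a. a + 0 = a"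
    "\<forall>a b :: 'a. a + (b + 1) = a + b + 1" "\<forall>a :: 'a. a * 0 = 0"
    "\<forall>a b :: 'a. a * (b + 1) = a * b + a" "\<forall>a :: 'a. \<not> a < 0"
    "\<forall>a b :: 'a. (a < b + 1 \<longrightarrow> \<not> a < b \<longrightarrow> a = b) \<and> (\<not> a < b \<and> a \<noteq> b \<or> a < b + 1)"
    unfolding basic_axioms_def sentence_def allN'_def neg'_def imp'_def eq'_def add'_def one'_def
      zero'_def mul'_def less'_def iff'_def dis'_def
    by simp_all
  show "a + 1 \<noteq> 0" using *(1) by blast
  show "a + 1 = b + 1 \<Longrightarrow> a = b" using *(2) by blast
  show "a + 0 = a" using *(3) by blast
  show "a + (b + 1) = a + b + 1" using *(4) by blast
  show "a * 0 = 0" using *(5) by blast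
  show "a * (b + 1) = a * b + a" using *(6) by blast
  show "\<not> a < 0" using *(7) by blast
  show "a < b + 1 \<longleftrightarrow> a < b \<or> a = b" using *(8)[THEN spec[of _ a], THEN spec[of _ b]] by argo
qed

section \<open>Semiring laws and order\<close>

lemma add_assoc_rca0: "a + b + c = a + (b + c)" for a b c :: "'a::rca0"
  by (rule delta0_induct[where P = "\<lambda>c. a + b + c = a + (b + c)"], intro d0_intros)
     (simp_all add: rca0_axioms(3,4))

lemma add_0_left_rca0: "0 + a = a" for a :: "'a::rca0"
  by (rule delta0_induct[where P = "\<lambda>a. 0 + a = a"], intro d0_intros)
     (simp_all add: rca0_axioms(3,4))

lemma add_1_left_rca0: "a + 1 + b = a + b + 1" for a b :: "'a::rca0"
  by (rule delta0_induct[where P = "\<lambda>b. a + 1 + b = a + b + 1"], intro d0_intros)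
     (simp_all add: rca0_axioms(3,4))

lemma add_commute_rca0: "a + b = b + a" for a b :: "'a::rca0"
  by (rule delta0_induct[where P = "\<lambda>b. a + b = b + a"], intro d0_intros)
     (simp_all add: rca0_axioms(3,4) add_0_left_rca0 add_1_left_rca0)

lemma add_left_commute_rca0: "a + (b + c) = b + (a + c)" for a b c :: "'a::rca0"
  by (metis add_assoc_rca0 add_commute_rca0)

lemmas add_ac_rca0 = add_assoc_rca0 add_commute_rca0 add_left_commute_rca0

lemma add_cancel_rca0: "a + c = b + c \<Longrightarrow> a = b" for a b c :: "'a::rca0"
  by (rule delta0_induct[where P = "\<lambda>c. a + c = b + c \<longrightarrow> a = b", rule_format], intro d0_intros)
     (auto simp: rca0_axioms(3,4) dest: add_1_inject)

lemma mult_0_left_rca0: "0 * a = 0" for a :: "'a::rca0"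
  by (rule delta0_induct[where P = "\<lambda>a. 0 * a = 0"], intro d0_intros)
     (simp_all add: rca0_axioms)

lemma distrib_rca0: "a * (b + c) = a * b + a * c" for a b c :: "'a::rca0"
  by (rule delta0_induct[where P = "\<lambda>c. a * (b + c) = a * b + a * c"], intro d0_intros)
     (simp_all add: add_0_rca0 mult_0_rca0 mult_add_1 add_assoc_rca0[symmetric])

lemma mult_add_1_left_rca0: "(a + 1) * b = a * b + b" for a b :: "'a::rca0"
proof (rule delta0_induct[where P = "\<lambda>b. (a + 1) * b = a * b + b"], intro d0_intros)
  show "(a + 1) * (x + 1) = a * (x + 1) + (x + 1)" if "(a + 1) * x = a * x + x" for x
    by (simp only: mult_add_1 that) (simp only: add_ac_rca0)
qed (simp_all add: mult_0_rca0 add_0_rca0)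

lemma mult_commute_rca0: "a * b = b * a" for a b :: "'a::rca0"
  by (rule delta0_induct[where P = "\<lambda>b. a * b = b * a"], intro d0_intros)
     (simp_all add: rca0_axioms(5,6) mult_0_left_rca0 mult_add_1_left_rca0)

lemma mult_assoc_rca0: "a * b * c = a * (b * c)" for a b c :: "'a::rca0"
  by (rule delta0_induct[where P = "\<lambda>c. a * b * c = a * (b * c)"], intro d0_intros)
     (simp_all only: mult_0_rca0 mult_add_1 distrib_rca0[of a "b * _" b] zero_less_Suc)

lemma mult_1_rca0: "1 * a = a" for a :: "'a::rca0"
  using mult_add_1_left_rca0[of 0 a] by (simp add: add_0_left_rca0 mult_0_left_rca0)

lemma zero_or_add_1: "a = 0 \<or> (\<exists>b. a = b + 1)" for a :: "'a::rca0"
proof -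
  \<comment> \<open>The disjunction is moved under the quantifier to give the induction predicate
    its Sigma-1 shape.\<close>
  have "\<exists>b. a = 0 \<or> a = b + 1"
    by (rule sigma1_induct[where P = "\<lambda>a. \<exists>b. a = 0 \<or> a = b + 1"], rule s1_ex_d0, intro d0_intros)
       auto
  then show ?thesis by blast
qed

lemma less_add_1_right: "a < a + c + 1" for a c :: "'a::rca0"
  by (rule delta0_induct[where P = "\<lambda>c. a < a + c + 1"], intro d0_intros)
     (simp_all add: rca0_axioms(3,4,8))

text \<open>Reduces the order to addition, from which linearity, irreflexivity and transitivity
  follow.\<close>

lemma less_rca0: "a < b \<longleftrightarrow> (\<exists>c. b = a + c + 1)" for a b :: "'a::rca0"
proof
  have "\<exists>c. a < b \<longrightarrow> b = a + c + 1"
  proof (rule sigma1_induct[where P = "\<lambda>b. \<exists>c. a < b \<longrightarrow> b = a + c + 1"], rule s1_ex_d0, intro d0_intros)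
    fix x assume "\<exists>c. a < x \<longrightarrow> x = a + c + 1"
    then show "\<exists>c. a < x + 1 \<longrightarrow> x + 1 = a + c + 1"
      by (metis rca0_axioms(3,4,8))
  qed (simp_all add: rca0_axioms)
  then show "a < b \<Longrightarrow> \<exists>c. b = a + c + 1" by blast
qed (auto simp: less_add_1_right)

lemma linear_rca0: "a < b \<or> a = b \<or> b < a" for a b :: "'a::rca0"
proof (rule delta0_induct[where P = "\<lambda>b. a < b \<or> a = b \<or> b < a"], intro d0_intros)
  show "a < 0 \<or> a = 0 \<or> 0 < a"
    using zero_or_add_1[of a] less_add_1_right[of 0] by (auto simp: add_0_left_rca0)
  fix x assume "a < x \<or> a = x \<or> x < a"
  moreover have "a = x + 1 \<or> x + 1 < a" if x: "x < a"
  proof -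
    obtain c where c: "a = x + c + 1" using x less_rca0 by blast
    show ?thesis using zero_or_add_1[of c] c add_1_left_rca0[of x c]
      by (metis add_0_rca0 less_rca0 add_add_1)
  qed
  ultimately show "a < x + 1 \<or> a = x + 1 \<or> x + 1 < a" by (auto simp: less_add_1)
qed simp_all

lemma less_irrefl_rca0: "\<not> a < a" for a :: "'a::rca0"
proof
  assume "a < a"
  then obtain c where "a = a + c + 1" using less_rca0[of a a] by auto
  then have "0 + a = (c + 1) + a" by (metis add_0_left_rca0 add_assoc_rca0 add_commute_rca0)
  then show False using add_cancel_rca0 add_1_neq_0 by metis
qed

lemma less_trans_rca0: "a < b \<Longrightarrow> b < c \<Longrightarrow> a < c" for a b c :: "'a::rca0"
  by (auto simp: less_rca0) (metis add_assoc_rca0)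

lemma minus_add_rca0: "a + b - a = b" for a b :: "'a::rca0"
proof -
  have "(THE c. a + b = a + c) = b"
    by (rule the_equality) (use add_cancel_rca0 add_commute_rca0 in metis)+
  then show ?thesis unfolding minus_rca0 by auto
qed

lemma minus_less_rca0: "a < b \<Longrightarrow> a - b = 0" for a b :: "'a::rca0"
proof -
  assume "a < b"
  have "a \<noteq> b + c" for c
  proof
    assume "a = b + c"
    with zero_or_add_1[of c] have "b < a \<or> a = b"
      by (elim disjE exE) (simp_all only: add_0_rca0 add_add_1 less_add_1_right simp_thms)
    then show False using \<open>a < b\<close> less_trans_rca0[of a b a] less_irrefl_rca0[of a] by auto
  qed
  then show ?thesis unfolding minus_rca0 by auto
qed

lemma le_rca0: "a \<le> b \<longleftrightarrow> (\<exists>c. b = a + c)" for a b :: "'a::rca0"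
proof
  show "\<exists>c. b = a + c" if "a \<le> b"
    using that unfolding less_eq_rca0 less_rca0
  proof (elim disjE exE)
    show "\<exists>c. b = a + c" if "b = a + d + 1" for d using that by (auto simp: add_assoc_rca0)
    show "\<exists>c. b = a + c" if "a = b" by (rule exI[of _ 0]) (simp add: add_0_rca0 that)
  qed
  show "a \<le> b" if ex: "\<exists>c. b = a + c"
  proof -
    obtain c where b: "b = a + c" using ex by blast
    show ?thesis using zero_or_add_1[of c] unfolding less_eq_rca0
      by (elim disjE exE) (simp_all only: b add_0_rca0 add_add_1 less_add_1_right simp_thms)
  qed
qed

text \<open>From here on the rules for ordered semirings, in particular
  \<open>algebra_simps\<close>, apply to the elements of a model.\<close>

instance rca0 \<subseteq> linordered_semidom
proof
  fix a b c :: 'a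
  show "a + b + c = a + (b + c)" by (rule add_assoc_rca0)
  show ab: "a + b = b + a" for a b :: 'a by (rule add_commute_rca0)
  show "0 + a = a" by (rule add_0_left_rca0)
  show "a * b * c = a * (b * c)" by (rule mult_assoc_rca0)
  show "a * b = b * a" by (rule mult_commute_rca0)
  show "1 * a = a" by (rule mult_1_rca0)
  show dist: "(a + b) * c = a * c + b * c" for a b c :: 'a by (metis distrib_rca0 mult_commute_rca0)
  show "(0 :: 'a) \<noteq> 1" using add_1_neq_0[of 0] add_0_left_rca0[of 1] by metis
  show "a + b - a = b" by (rule minus_add_rca0)
  have le: "x < y \<or> (\<exists>z. x = y + z)" for x y :: 'a
    using linear_rca0[of x y] less_eq_rca0 le_rca0 by metis
  have less_add: "x < y + z" if "x < y" for x y z :: 'a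
    using that unfolding less_rca0 by (metis add_assoc_rca0 add_commute_rca0)
  show "a - b - c = a - (b + c)"
  proof (cases "a < b")
    case True
    moreover have "0 - c = 0"
      using zero_or_add_1[of c] minus_less_rca0[of 0 c] minus_add_rca0[of 0 0] less_rca0[of 0 c]
      by (auto simp: add_0_left_rca0)
    ultimately show ?thesis using minus_less_rca0 less_add by metis
  next
    case False
    then obtain d where d: "a = b + d" using le by blast
    show ?thesis
    proof (cases "d < c")
      case True
      then have "a < b + c" unfolding d less_rca0 by (metis add_assoc_rca0)
      with True d show ?thesis using minus_less_rca0 minus_add_rca0 by metis
    next
      case False
      then obtain f where "d = c + f" using le by blast
      with d show ?thesis using minus_add_rca0 add_assoc_rca0 by metis
    qed
  qed
  show "a * 0 = 0" "0 * a = 0" by (rule mult_0_rca0, rule mult_0_left_rca0)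
  show mono: "c * a < c * b" if ab: "a < b" and c: "0 < c"
  proof -
    obtain d where "b = a + d + 1" using ab unfolding less_rca0 by auto
    moreover obtain f where "c = 0 + f + 1" using c unfolding less_rca0 by auto
    ultimately have *: "b = a + (d + 1)" "c = f + 1" by (simp_all only: add_assoc_rca0 add_0_left_rca0)
    have "c * b = c * a + (c * d + c)" by (simp only: *(1) distrib_rca0[of _ a] mult_add_1)
    also have "\<dots> = c * a + (c * d + f) + 1" by (subst (3) *(2)) (simp only: add_assoc_rca0)
    finally show ?thesis unfolding less_rca0 by blast
  qed
  show "a * (b - c) = a * b - a * c"
  proof (cases "b < c")
    case True
    then obtain d where d: "c = b + d + 1" unfolding less_rca0 by auto
    then have "a * c = a * b + a * (d + 1)" by (simp add: distrib_rca0 add_assoc_rca0)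
    then have "a * b - a * c = 0"
      using minus_less_rca0[of "a * b" "a * c"] minus_add_rca0[of "a * b" 0] zero_or_add_1[of "a * (d + 1)"]
      by (metis add_0_rca0 less_rca0 add_add_1)
    with True show ?thesis by (simp only: minus_less_rca0 mult_0_rca0)
  next
    case False
    then obtain d where "b = c + d" using le by blast
    then show ?thesis by (simp add: distrib_rca0 minus_add_rca0)
  qed
  show "a * (b + c) = a * b + a * c" by (rule distrib_rca0)
  show "a \<le> a" by (simp add: less_eq_rca0)
  show "a \<le> b \<or> b \<le> a" using linear_rca0[of a b] by (auto simp: less_eq_rca0)
  show "a < b \<longleftrightarrow> a \<le> b \<and> \<not> b \<le> a"
    using less_trans_rca0[of a b a] less_irrefl_rca0[of a] linear_rca0[of a b] by (auto simp: less_eq_rca0)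
  show "a \<le> c" if "a \<le> b" "b \<le> c"
    using that less_trans_rca0[of a b c] by (auto simp: less_eq_rca0)
  show "a = b" if "a \<le> b" "b \<le> a"
    using that less_trans_rca0[of a b a] less_irrefl_rca0[of a] by (auto simp: less_eq_rca0)
  show "c + a \<le> c + b" if "a \<le> b"
    using that by (auto simp: le_rca0 add_assoc_rca0)
  show "a * b \<noteq> 0" if "a \<noteq> 0" "b \<noteq> 0"
    using zero_or_add_1[of a] zero_or_add_1[of b] that
    by (elim disjE exE) (simp_all only: mult_add_1 add_add_1 add_1_neq_0 simp_thms)
  show "(0 :: 'a) < 1" using less_add_1_right[of 0 0] by (simp only: add_0_rca0 add_0_left_rca0)
  show "a - b + b = a" if "b \<le> a"
  proof -
    obtain d where "a = b + d" using \<open>b \<le> a\<close> unfolding le_rca0 by auto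
    then show ?thesis by (simp only: minus_add_rca0 ab)
  qed
qed

instance rca0 \<subseteq> ordered_cancel_comm_monoid_diff
proof
  fix a b :: 'a
  show "a \<le> b \<longleftrightarrow> (\<exists>c. b = a + c)" by (rule le_rca0)
  show "0 - a = 0"
    using minus_less_rca0[of 0 a] linear_rca0[of 0 a] not_less_0_rca0[of a] by auto
qed

lemma less_add_1_iff [simp]: "a < b + 1 \<longleftrightarrow> a \<le> b" for a b :: "'a::rca0"
  by (auto simp: less_add_1 order_le_less)

lemma add_1_le_iff: "a + 1 \<le> b \<longleftrightarrow> a < b" for a b :: "'a::rca0"
  by (subst not_less[symmetric]) (simp add: not_le)

text \<open>Two unbounded witnesses are contracted to one: a single \<open>b\<close>, such as
  \<open>x + v + 1\<close>, bounds both, and their quantifiers become bounded.\<close>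

lemma s1_ex:
  assumes "s1 (Suc k) (\<lambda>e. Q (e 0) (\<lambda>i. e (Suc i)))"
  shows "s1 k (\<lambda>e. \<exists>x. Q x e)"
proof -
  obtain R where R: "d0 (Suc (Suc k)) (\<lambda>e. R (e 0) (\<lambda>i. e (Suc i)))"
    "\<And>e. Q (e 0) (\<lambda>i. e (Suc i)) = (\<exists>v. R v e)"
    using assms unfolding s1_def by blast
  have Q: "Q x e = (\<exists>v. R v (case_nat x e))" for x e using R(2)[of "case_nat x e"] by simp
  have "(\<exists>x. Q x e) \<longleftrightarrow> (\<exists>b. \<exists>x. x < b \<and> (\<exists>v. v < b \<and> R v (case_nat x e)))" for e
  proof -
    have "x < x + v + 1" "v < x + v + 1" for x v :: 'a by simp_all
    then show ?thesis unfolding Q by blast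
  qed
  moreover have "s1 k (\<lambda>e. \<exists>b. \<exists>x. x < b \<and> (\<exists>v. v < b \<and> R v (case_nat x e)))"
  proof (rule s1_ex_d0, intro d0_intros)
    \<comment> \<open>The arguments are now \<open>v\<close>, \<open>x\<close>, \<open>b\<close> and
      then the old ones; \<open>R\<close> expects \<open>v\<close>, \<open>x\<close> and the old
      ones, so \<open>?f\<close> skips index 2.\<close>
    let ?f = "case_nat 0 (case_nat (Suc 0) (\<lambda>i. Suc (Suc (Suc i))))"
    have "d0 (Suc (Suc (Suc k))) (\<lambda>e. R (e (?f 0)) (\<lambda>i. e (?f (Suc i))))"
      by (rule d0_rename[OF R(1)]) (auto split: nat.splits)
    moreover have "(\<lambda>i. e (?f (Suc i))) = case_nat (e (Suc 0)) (\<lambda>i. e (Suc (Suc (Suc i))))" for e :: "nat \<Rightarrow> 'a"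
      by (auto simp: fun_eq_iff split: nat.split)
    ultimately show "d0 (Suc (Suc (Suc k))) (\<lambda>e. R (e 0) (case_nat (e (Suc 0)) (\<lambda>i. e (Suc (Suc (Suc i))))))"
      by simp
  qed simp_all
  ultimately show ?thesis by simp
qed

lemma least_element:
  fixes X :: "'a::rca0 set"
  assumes "X \<in> sets" "x \<in> X"
  obtains m where "m \<in> X" "\<And>y. y < m \<Longrightarrow> y \<notin> X"
proof (rule ccontr)
  assume "\<not> thesis"
  with that have no_least: "m \<in> X \<Longrightarrow> \<exists>y<m. y \<in> X" for m by blast
  \<comment> \<open>The bound on \<open>y\<close> makes this course-of-values induction
    Delta-0.\<close>
  have "\<forall>y. y < n \<longrightarrow> y \<notin> X" for n
    by (rule delta0_induct[where P = "\<lambda>n. \<forall>y. y < n \<longrightarrow> y \<notin> X"], intro d0_intros)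
       (use assms(1) no_least in \<open>auto simp: order_le_less\<close>)
  from this[of "x + 1"] show False using assms(2) by auto
qed

section \<open>Coding of finite sets and exponentiation\<close>

definition pair :: "'a::rca0 \<Rightarrow> 'a \<Rightarrow> 'a" where
  "pair a b = (a + b) * (a + b) + a"

lemma tmd_pair [d0_intros]: "tmd k T \<Longrightarrow> tmd k U \<Longrightarrow> tmd k (\<lambda>e. pair (T e) (U e))"
  unfolding pair_def by (intro d0_intros)

lemma le_mult_self: "a \<le> a * a" for a :: "'a::rca0"
  using zero_or_add_1[of a] mult_left_mono[of 1 a a] by auto

lemma pair_ge: "a \<le> pair a b" "b \<le> pair a b"
proof -
  show "a \<le> pair a b" by (simp add: pair_def)
  have "b \<le> a + b" by simp
  also have "\<dots> \<le> (a + b) * (a + b)" by (rule le_mult_self)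
  also have "\<dots> \<le> pair a b" by (simp add: pair_def)
  finally show "b \<le> pair a b" .
qed

text \<open>The code of \<open>(a, b)\<close> lies below the next square
  \<open>(a + b + 1) * (a + b + 1)\<close>, so codes are ordered first by the sum. Injectivity
  follows since the code determines the sum.\<close>

lemma pair_less: "a + b < c + d \<Longrightarrow> pair a b < pair c d"
proof -
  assume "a + b < c + d"
  then have le: "a + b + 1 \<le> c + d" by (simp add: add_1_le_iff)
  have "(a + b + 1) * (a + b + 1) = pair a b + (a + b + b) + 1"
    by (simp add: pair_def algebra_simps)
  then have "pair a b < (a + b + 1) * (a + b + 1)" by (simp only: less_add_1_right)
  also have "\<dots> \<le> (c + d) * (c + d)" using le by (intro mult_mono) simp_all
  also have "\<dots> \<le> pair c d" by (simp add: pair_def)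
  finally show ?thesis .
qed

text \<open>In the doubling recursion a predecessor has the smaller code, so following predecessors
  never leaves a bound on the codes.\<close>

lemma pair_less_double: "pair a b < pair (a + 1) (b + b)"
proof (rule pair_less)
  have "a + 1 + (b + b) = a + b + b + 1" by (simp add: ac_simps)
  then show "a + b < a + 1 + (b + b)" by (simp only: less_add_1_right)
qed

lemma pair_inject [simp]: "pair a b = pair c d \<longleftrightarrow> a = c \<and> b = d"
proof
  assume eq: "pair a b = pair c d"
  have "a + b = c + d"
    using pair_less[of a b c d] pair_less[of c d a b] eq by (metis less_irrefl linorder_less_linear)
  moreover from this eq have "a = c" by (simp add: pair_def)
  ultimately show "a = c \<and> b = d" by simp
qed simp

section \<open>Divisibility and codes of finite sets\<close>

lemma dvd_le: "a dvd b \<Longrightarrow> b \<noteq> 0 \<Longrightarrow> a \<le> b" for a b :: "'a::rca0"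
proof (elim dvdE)
  fix q assume b: "b = a * q" "b \<noteq> 0"
  then obtain r where "q = r + 1" using zero_or_add_1[of q] by auto
  with b show ?thesis by (simp add: algebra_simps)
qed

text \<open>A quotient can be chosen no larger than the dividend, even if that is zero, so a bounded
  quantifier suffices. The assumptions at \<open>Suc k\<close> move the terms under this
  quantifier.\<close>

lemma d0_dvd [d0_intros]:
  assumes "tmd k T" "tmd k U" "tmd (Suc k) (\<lambda>e. T (\<lambda>i. e (Suc i)))" "tmd (Suc k) (\<lambda>e. U (\<lambda>i. e (Suc i)))"
  shows "d0 k (\<lambda>e. T e dvd U e)"
proof -
  have "T e dvd U e \<longleftrightarrow> (\<exists>q. q < U e + 1 \<and> U e = T e * q)" for e
    using dvd_le[of _ "U e"] by (auto simp: dvd_def mult.commute) (metis dvd_triv_right le_cases mult_zero_right zero_le)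
  then show ?thesis by (simp only:) (intro d0_intros assms, simp)
qed

lemma common_multiple: "\<exists>m. 0 < m \<and> (\<forall>d. d < n \<longrightarrow> d + 1 dvd m)" for n :: "'a::rca0"
proof (rule sigma1_induct[where P = "\<lambda>n. \<exists>m. 0 < m \<and> (\<forall>d. d < n \<longrightarrow> d + 1 dvd m)"])
  show "s1 (Suc 0) (\<lambda>e. \<exists>m :: 'a. 0 < m \<and> (\<forall>d. d < e 0 \<longrightarrow> d + 1 dvd m))"
    by (rule s1_ex_d0, intro d0_intros) simp_all
  show "\<exists>m :: 'a. 0 < m \<and> (\<forall>d. d < 0 \<longrightarrow> d + 1 dvd m)" by (intro exI[of _ 1]) simp
  fix n :: 'a assume "\<exists>m. 0 < m \<and> (\<forall>d. d < n \<longrightarrow> d + 1 dvd m)"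
  then obtain m where m: "0 < m" "\<And>d. d < n \<Longrightarrow> d + 1 dvd m" by blast
  then have "d + 1 dvd m * (n + 1)" if "d \<le> n" for d
    using that by (cases "d = n") auto
  with m(1) show "\<exists>m. 0 < m \<and> (\<forall>d. d < n + 1 \<longrightarrow> d + 1 dvd m)"
    by (intro exI[of _ "m * (n + 1)"]) (auto simp: add_pos_nonneg)
qed

text \<open>The moduli \<open>(z + 1) m + 1\<close> for \<open>z < n\<close> are coprime when \<open>m\<close> is divisible by \<open>1, \<dots>, n\<close>; so the
product of those with \<open>z \<in> X\<close> codes \<open>X \<inter> {..<n}\<close>.\<close>

lemma coprime_moduli:
  fixes w :: "'a::rca0"
  assumes m: "\<And>d. d < n \<Longrightarrow> d + 1 dvd m" and "z < n" "j < n" "z \<noteq> j"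
    and dvd: "(z + 1) * m + 1 dvd w * ((j + 1) * m + 1)"
  shows "(z + 1) * m + 1 dvd w"
proof -
  let ?p = "(z + 1) * m + 1" and ?q = "(j + 1) * m + 1"
  \<comment> \<open>\<open>(j + 1) * ?p\<close> and \<open>(z + 1) * ?q\<close> differ exactly by
    the distance \<open>d + 1\<close> of \<open>j\<close> and \<open>z\<close>, since the multiples
    of \<open>m\<close> cancel. As \<open>?p\<close> divides \<open>w * ?q\<close>, it divides
    \<open>w * (d + 1)\<close>.\<close>
  obtain d where d: "d < n" "?p dvd w * (d + 1)"
  proof (cases "z < j")
    case True
    then obtain d where d: "j = z + d + 1" unfolding less_rca0 by auto
    have eq: "w * (j + 1) * ?p = (w * ?q) * (z + 1) + w * (d + 1)"
      by (simp add: d algebra_simps)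
    have "?p dvd (w * ?q) * (z + 1) + w * (d + 1)" unfolding eq[symmetric] by simp
    then have "?p dvd w * (d + 1)" using dvd_add_right_iff[of ?p "(w * ?q) * (z + 1)"] dvd by auto
    moreover have "d \<le> j" by (simp add: d add.assoc add_increasing)
    ultimately show ?thesis using \<open>j < n\<close> by (intro that) auto
  next
    case False
    then have "j < z" using \<open>z \<noteq> j\<close> by auto
    then obtain d where d: "z = j + d + 1" unfolding less_rca0 by auto
    have eq: "(w * ?q) * (z + 1) = w * (j + 1) * ?p + w * (d + 1)"
      by (simp add: d algebra_simps)
    have "?p dvd w * (j + 1) * ?p + w * (d + 1)" unfolding eq[symmetric] using dvd by (rule dvd_mult2)
    then have "?p dvd w * (d + 1)" using dvd_add_right_iff[of ?p "w * (j + 1) * ?p"] by auto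
    moreover have "d \<le> z" by (simp add: d add.assoc add_increasing)
    ultimately show ?thesis using \<open>z < n\<close> by (intro that) auto
  qed
  \<comment> \<open>As \<open>d + 1\<close> divides \<open>m\<close>, \<open>?p\<close> divides
    \<open>w * (z + 1) * m\<close>, and this differs from \<open>w * ?p\<close> by
    \<open>w\<close>.\<close>
  obtain r where "m = (d + 1) * r" using m[OF d(1)] by (elim dvdE)
  then have "w * (z + 1) * m = w * (d + 1) * (r * (z + 1))" by (simp add: ac_simps)
  then have "?p dvd w * (z + 1) * m" using d(2) by (simp only: dvd_mult2)
  moreover have "w * ?p = w * (z + 1) * m + w" by (simp add: algebra_simps)
  then have "?p dvd w * (z + 1) * m + w" using dvd_triv_right[of ?p w] by simp
  ultimately show ?thesis using dvd_add_right_iff by blast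
qed

text \<open>Induction on \<open>j\<close> takes care of the elements below \<open>j\<close>,
  multiplying by one modulus for each new element. \<open>X\<close> enters as a set parameter, so
  the predicate is Sigma-1.\<close>

lemma set_code:
  fixes X :: "'a::rca0 set"
  assumes X: "X \<in> sets"
  shows "\<exists>w m. \<forall>z<n. (z + 1) * m + 1 dvd w \<longleftrightarrow> z \<in> X"
proof -
  obtain m where m: "0 < m" "\<And>d. d < n \<Longrightarrow> d + 1 dvd m" using common_multiple[of n] by blast
  let ?P = "\<lambda>j. \<exists>w. \<forall>z. z < n \<longrightarrow> ((z + 1) * m + 1 dvd w \<longleftrightarrow> z \<in> X \<and> z < j)"
  have "?P n"
  proof (rule sigma1_induct[where P = ?P])
    show "s1 (Suc 0) (\<lambda>e. ?P (e 0))"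
      by (rule s1_ex_d0, intro d0_intros X) simp_all
    \<comment> \<open>Positivity of \<open>m\<close> keeps every modulus above 1, so that
      \<open>1\<close> codes the empty set.\<close>
    have "\<not> (z + 1) * m + 1 dvd 1" for z
    proof
      assume "(z + 1) * m + 1 dvd 1"
      then have "(z + 1) * m + 1 \<le> 1" by (rule dvd_le) simp
      then show False using m(1) by (simp add: algebra_simps)
    qed
    then show "?P 0" by (intro exI[of _ 1]) simp
    fix j assume "?P j"
    then obtain w where w: "\<And>z. z < n \<Longrightarrow> (z + 1) * m + 1 dvd w \<longleftrightarrow> z \<in> X \<and> z < j" by blast
    show "?P (j + 1)"
    proof (cases "j \<in> X \<and> j < n")
      case True
      have "(z + 1) * m + 1 dvd w * ((j + 1) * m + 1) \<longleftrightarrow> z \<in> X \<and> z < j + 1" if "z < n" for z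
      proof (cases "z = j")
        case False
        then have "(z + 1) * m + 1 dvd w * ((j + 1) * m + 1) \<longleftrightarrow> (z + 1) * m + 1 dvd w"
          using coprime_moduli[OF m(2) that _ False] True dvd_mult2 by blast
        with w[OF that] False show ?thesis by auto
      qed (use True in simp)
      then show ?thesis by blast
    next
      case False
      then have "(z + 1) * m + 1 dvd w \<longleftrightarrow> z \<in> X \<and> z < j + 1" if "z < n" for z
        using w[OF that] that by (cases "z = j") auto
      then show ?thesis by blast
    qed
  qed
  then show ?thesis by blast
qed

text \<open>The pair \<open>(w, m)\<close> codes a finite set of pairs that contains \<open>(t, y)\<close> and witnesses \<open>y = 2^t\<close>.\<close>

definition doubling_code :: "'a::rca0 \<Rightarrow> 'a \<Rightarrow> 'a \<Rightarrow> 'a \<Rightarrow> bool" where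
  "doubling_code w m t y \<longleftrightarrow> (pair t y + 1) * m + 1 dvd w \<and>
     (\<forall>z. z < pair t y + 1 \<longrightarrow> (z + 1) * m + 1 dvd w \<longrightarrow> z = pair 0 1 \<or>
       (\<exists>i. i < z + 1 \<and> (\<exists>u. u < z + 1 \<and> z = pair (i + 1) (u + u) \<and> (pair i u + 1) * m + 1 dvd w)))"

lemma d0_doubling_code:
  "i < k \<Longrightarrow> j < k \<Longrightarrow> l < k \<Longrightarrow> n < k \<Longrightarrow> d0 k (\<lambda>e. doubling_code (e i) (e j) (e l) (e n))"
  unfolding doubling_code_def by (intro d0_intros) simp_all

text \<open>The two codes may use different moduli, so their members are compared level by level: by
  induction on the exponent \<open>i\<close>, members \<open>(i, u)\<close> and
  \<open>(i, u')\<close> agree, because each arises by doubling from a member one level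
  below.\<close>

lemma doubling_code_unique:
  assumes c: "doubling_code w m t y" "doubling_code w' m' t y'"
  shows "y = y'"
proof -
  \<comment> \<open>A code is constrained only up to the pair that it certifies, hence the bounds on
    members; they also make the predicate Delta-0.\<close>
  let ?P = "\<lambda>i. \<forall>u. u < pair t y + 1 \<longrightarrow> (\<forall>u'. u' < pair t y' + 1 \<longrightarrow>
    pair i u < pair t y + 1 \<longrightarrow> (pair i u + 1) * m + 1 dvd w \<longrightarrow>
    pair i u' < pair t y' + 1 \<longrightarrow> (pair i u' + 1) * m' + 1 dvd w' \<longrightarrow> u = u')"
  have neq: "(1 :: 'a) \<noteq> 0" "i + 1 \<noteq> (0 :: 'a)" "0 \<noteq> i + (1 :: 'a)" for i by (simp_all)
  have step: "u = 1" if "doubling_code w m t y" "pair 0 u \<le> pair t y" "(pair 0 u + 1) * m + 1 dvd w"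
    for w m t y u :: 'a
    using that neq unfolding doubling_code_def by (auto dest!: spec[of _ "pair 0 u"])
  have step': "\<exists>v. u = v + v \<and> v \<le> pair t y \<and> pair i v \<le> pair t y \<and> (pair i v + 1) * m + 1 dvd w"
    if d: "doubling_code w m t y" "pair (i + 1) u \<le> pair t y" "(pair (i + 1) u + 1) * m + 1 dvd w"
    for w m t y u i :: 'a
  proof -
    obtain v where v: "u = v + v" "(pair i v + 1) * m + 1 dvd w"
      using d neq unfolding doubling_code_def by (auto dest!: spec[of _ "pair (i + 1) u"])
    have "pair i v \<le> pair t y" using pair_less_double[of i v] d(2) v(1) by auto
    moreover from this have "v \<le> pair t y" using pair_ge(2) order_trans by blast
    ultimately show ?thesis using v by blast
  qed
  have "?P t"
  proof (rule delta0_induct[where P = ?P])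
    show "d0 (Suc 0) (\<lambda>e. ?P (e 0))" by (intro d0_intros) simp_all
    show "?P 0" using step[OF c(1)] step[OF c(2)] by auto
    fix i assume IH: "?P i"
    show "?P (i + 1)"
    proof (intro allI impI)
      fix u u'
      assume "pair (i + 1) u < pair t y + 1" "(pair (i + 1) u + 1) * m + 1 dvd w"
        "pair (i + 1) u' < pair t y' + 1" "(pair (i + 1) u' + 1) * m' + 1 dvd w'"
      then show "u = u'" using step'[OF c(1), of i u] step'[OF c(2), of i u'] IH by auto
    qed
  qed
  then show ?thesis using c pair_ge(2) unfolding doubling_code_def by auto
qed

lemma doubling_code_0: "\<exists>w m. doubling_code w m 0 (1 :: 'a::rca0)"
proof -
  have "{z :: 'a. z = pair 0 1} \<in> sets"
    by (rule delta0_comprehension, intro d0_intros) simp_all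
  from set_code[OF this, of "pair 0 1 + 1"] obtain w m :: 'a where
    wm: "\<And>z. z \<le> pair 0 1 \<Longrightarrow> (z + 1) * m + 1 dvd w \<longleftrightarrow> z = pair 0 1" by auto
  then have "doubling_code w m 0 1" unfolding doubling_code_def by simp
  then show ?thesis by blast
qed

text \<open>Coprimality of the moduli depends on the bound, so \<open>(w, m)\<close> is not
  extended. The set that it codes, enlarged by the new pair, is formed by comprehension and coded
  afresh.\<close>

lemma doubling_code_add_1:
  fixes t y :: "'a::rca0"
  assumes "doubling_code w m t y"
  shows "\<exists>w m. doubling_code w m (t + 1) (y + y)"
proof -
  let ?P = "\<lambda>z. z < pair t y + 1 \<and> (z + 1) * m + 1 dvd w \<or> z = pair (t + 1) (y + y)"
  have "{z. ?P z} \<in> sets" by (rule delta0_comprehension, intro d0_intros) simp_all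
  from set_code[OF this, of "pair (t + 1) (y + y) + 1"] obtain w' m' where
    wm: "\<And>z. z \<le> pair (t + 1) (y + y) \<Longrightarrow> (z + 1) * m' + 1 dvd w' \<longleftrightarrow> ?P z" by auto
  have "doubling_code w' m' (t + 1) (y + y)"
    unfolding doubling_code_def less_add_1_iff
  proof (intro conjI allI impI)
    show "(pair (t + 1) (y + y) + 1) * m' + 1 dvd w'" by (simp add: wm)
    fix z assume z: "z \<le> pair (t + 1) (y + y)" "(z + 1) * m' + 1 dvd w'"
    then consider "z \<le> pair t y" "(z + 1) * m + 1 dvd w" | "z = pair (t + 1) (y + y)"
      using wm by auto
    then show "z = pair 0 1 \<or> (\<exists>i\<le>z. \<exists>u\<le>z. z = pair (i + 1) (u + u) \<and> (pair i u + 1) * m' + 1 dvd w')"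
    proof cases
      case 1
      then consider "z = pair 0 1" | i u where "i \<le> z" "u \<le> z" "z = pair (i + 1) (u + u)"
        "(pair i u + 1) * m + 1 dvd w"
        using assms unfolding doubling_code_def by auto
      then show ?thesis
      proof cases
        case (2 i u)
        then have "pair i u \<le> pair t y" "pair i u \<le> pair (t + 1) (y + y)"
          using pair_less_double[of i u] \<open>z \<le> pair t y\<close> z(1) by auto
        then have "(pair i u + 1) * m' + 1 dvd w'" using wm 2(4) by simp
        with 2 show ?thesis by blast
      qed blast
    next
      case 2
      have "(pair t y + 1) * m + 1 dvd w" using assms unfolding doubling_code_def by blast
      then have "(pair t y + 1) * m' + 1 dvd w'" using wm pair_less_double[of t y] by simp
      moreover have "t \<le> z" "y \<le> z"
        using pair_less_double[of t y] pair_ge(1)[of t y] pair_ge(2)[of y t] unfolding 2 by auto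
      ultimately show ?thesis using 2 by blast
    qed
  qed
  then show ?thesis by blast
qed

text \<open>Codes make the graph Sigma-1. Since values exist and are unique, \<open>y\<close> fails
  to be the value at \<open>t\<close> exactly when a code certifies a different \<open>y'\<close>,
  so the graph is Delta-1 and hence a set.\<close>

theorem power_of_two_exists:
  "\<exists>f :: 'a::rca0 \<Rightarrow> 'a. f 0 = 1 \<and> (\<forall>t. f (t + 1) = f t + f t) \<and> {pair t (f t) |t. True} \<in> sets"
proof -
  define f where "f t = (THE y. \<exists>w m. doubling_code w m t y)" for t :: 'a
  have ex: "\<exists>y w m. doubling_code w m t y" for t :: 'a
  proof (rule sigma1_induct[where P = "\<lambda>t. \<exists>y w m. doubling_code w m t y"])
    show "s1 (Suc 0) (\<lambda>e. \<exists>y w m. doubling_code w m (e 0 :: 'a) y)"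
      by (rule s1_ex, rule s1_ex, rule s1_ex_d0, rule d0_doubling_code) simp_all
  qed (use doubling_code_0 doubling_code_add_1 in blast)+
  have f: "f t = y \<longleftrightarrow> (\<exists>w m. doubling_code w m t y)" for t y
  proof -
    obtain y' w m where c: "doubling_code w m t y'" using ex[of t] by blast
    have "f t = y'"
      unfolding f_def
    proof (rule the_equality)
      show "\<exists>w m. doubling_code w m t y'" using c by blast
      show "x = y'" if "\<exists>w m. doubling_code w m t x" for x
        using that doubling_code_unique[OF _ c] by blast
    qed
    then show ?thesis using c doubling_code_unique[OF _ c] by blast
  qed
  have "f 0 = 1" using doubling_code_0 f by blast
  moreover have "f (t + 1) = f t + f t" for t
    using f[of t "f t"] doubling_code_add_1 f[of "t + 1" "f t + f t"] by blast
  moreover have "{z :: 'a. \<exists>t y w m. z = pair t y \<and> doubling_code w m t y} \<in> sets"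
  proof (rule delta1_comprehension)
    show "s1 (Suc 0) (\<lambda>e. \<exists>t y w m. (e 0 :: 'a) = pair t y \<and> doubling_code w m t y)"
      by (rule s1_ex, rule s1_ex, rule s1_ex, rule s1_ex_d0, intro d0_intros d0_doubling_code) simp_all
    \<comment> \<open>A number outside the graph is either no pair at all, which is a bounded
      condition, or a pair refuted by another value.\<close>
    have "(\<not> (\<exists>t y w m. z = pair t y \<and> doubling_code w m t y)) \<longleftrightarrow>
        (\<exists>t y y' w m. z = pair t y \<and> y \<noteq> y' \<and> doubling_code w m t y' \<or>
          \<not> (\<exists>t. t < z + 1 \<and> (\<exists>y. y < z + 1 \<and> z = pair t y)))" for z :: 'a
    proof (cases "\<exists>t y. z = pair t y")
      case True
      then obtain t y where z: "z = pair t y" by blast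
      have "\<exists>t. t < z + 1 \<and> (\<exists>y. y < z + 1 \<and> z = pair t y)"
        using z pair_ge(1)[of t y] pair_ge(2)[of y t] by auto
      then have "(\<exists>t y y' w m. z = pair t y \<and> y \<noteq> y' \<and> doubling_code w m t y' \<or>
          \<not> (\<exists>t. t < z + 1 \<and> (\<exists>y. y < z + 1 \<and> z = pair t y))) \<longleftrightarrow> y \<noteq> f t"
        by (auto simp: z f[symmetric])
      moreover have "(\<not> (\<exists>t y w m. z = pair t y \<and> doubling_code w m t y)) \<longleftrightarrow> y \<noteq> f t"
        by (auto simp: z f[symmetric])
      ultimately show ?thesis by simp
    qed auto
    moreover have "s1 (Suc 0) (\<lambda>e. \<exists>t y y' w m. (e 0 :: 'a) = pair t y \<and> y \<noteq> y' \<and> doubling_code w m t y' \<or>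
          \<not> (\<exists>t. t < e 0 + 1 \<and> (\<exists>y. y < e 0 + 1 \<and> e 0 = pair t y)))"
      by (rule s1_ex, rule s1_ex, rule s1_ex, rule s1_ex, rule s1_ex_d0, intro d0_intros d0_doubling_code) simp_all
    ultimately show "s1 (Suc 0) (\<lambda>e. \<not> (\<exists>t y w m. (e 0 :: 'a) = pair t y \<and> doubling_code w m t y))"
      by simp
  qed
  moreover have "{z :: 'a. \<exists>t y w m. z = pair t y \<and> doubling_code w m t y} = {pair t (f t) |t. True}"
    by (auto simp: f[symmetric])
  ultimately show ?thesis by auto
qed

section \<open>The meaning of the two principles\<close>

text \<open>This and the definitions that follow copy the shape of the evaluated formulas, so that
  \<open>sat_RT2\<close> and \<open>sat_AHT\<close> reduce to rewriting.\<close>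

definition fun_on :: "'a::rca0 set \<Rightarrow> ('a \<Rightarrow> bool) \<Rightarrow> ('a \<Rightarrow> bool) \<Rightarrow> bool" where
  "fun_on f D R \<longleftrightarrow> (\<forall>z. z \<in> f \<longrightarrow> (\<exists>x y. D x \<and> R y \<and> z = pair x y)) \<and>
     (\<forall>x. D x \<longrightarrow> (\<exists>y. (R y \<and> pair x y \<in> f) \<and> (\<forall>z. R z \<and> pair x z \<in> f \<longrightarrow> z = y)))"

definition increasing :: "'a::rca0 set \<Rightarrow> bool" where
  "increasing f \<longleftrightarrow> (\<forall>i j u v. pair i u \<in> f \<and> pair j v \<in> f \<and> i < j \<longrightarrow> u < v)"

definition unbounded :: "'a::rca0 set \<Rightarrow> bool" where
  "unbounded X \<longleftrightarrow> (\<forall>m. \<exists>n. m < n \<and> n \<in> X)"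

definition fin_sum :: "('a::rca0 \<Rightarrow> 'a \<Rightarrow> bool) \<Rightarrow> 'a \<Rightarrow> 'a \<Rightarrow> 'a \<Rightarrow> bool" where
  "fin_sum g a b x \<longleftrightarrow> (\<exists>s\<in>sets. fun_on s (\<lambda>x. a \<le> x \<and> x \<le> b) (\<lambda>_. True) \<and>
     (\<exists>v. g a v \<and> pair a v \<in> s) \<and>
     (\<forall>i. a \<le> i \<and> i < b \<longrightarrow> (\<exists>u v. pair i u \<in> s \<and> g (i + 1) v \<and> pair (i + 1) (u + v) \<in> s)) \<and>
     pair b x \<in> s)"

definition pow_rel :: "'a::rca0 \<Rightarrow> 'a \<Rightarrow> bool" where
  "pow_rel t y \<longleftrightarrow> (\<exists>e\<in>sets. fun_on e (\<lambda>_. True) (\<lambda>_. True) \<and> pair 0 1 \<in> e \<and>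
     (\<forall>i u. pair i u \<in> e \<longrightarrow> pair (i + 1) ((1 + 1) * u) \<in> e) \<and> pair t y \<in> e)"

definition bin_exp :: "'a::rca0 \<Rightarrow> 'a \<Rightarrow> 'a set \<Rightarrow> bool" where
  "bin_exp n p t \<longleftrightarrow> 1 \<le> p \<and> fun_on t (\<lambda>x. 1 \<le> x \<and> x \<le> p) (\<lambda>_. True) \<and> increasing t \<and>
     fin_sum (\<lambda>i v. \<exists>e. pair i e \<in> t \<and> pow_rel e v) 1 p n"

definition apart :: "'a::rca0 set \<Rightarrow> bool" where
  "apart X \<longleftrightarrow> (\<forall>x x'. x \<in> X \<and> x' \<in> X \<and> x < x' \<longrightarrow>
     (\<exists>m l. (\<exists>p. \<exists>t\<in>sets. bin_exp x p t \<and> pair p m \<in> t) \<and>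
        (\<exists>p. \<exists>t\<in>sets. bin_exp x' p t \<and> pair 1 l \<in> t) \<and> m < l))"

definition adj_sum :: "'a::rca0 set \<Rightarrow> 'a \<Rightarrow> bool" where
  "adj_sum H x \<longleftrightarrow> (\<exists>h\<in>sets. fun_on h (\<lambda>i. 1 \<le> i) (\<lambda>_. True) \<and> increasing h \<and>
     (\<forall>y. y \<in> H \<longleftrightarrow> (\<exists>i. 1 \<le> i \<and> pair i y \<in> h)) \<and>
     (\<exists>i j. 1 \<le> i \<and> i \<le> j \<and> fin_sum (\<lambda>m v. pair m v \<in> h) i j x))"

lemmas syntax_defs = sentence_def zero'_def one'_def add'_def mul'_def tru'_def eq'_def less'_def
  mem'_def neg'_def con'_def dis'_def imp'_def iff'_def allN'_def exN'_def allS'_def exS'_def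
  le'_def ex1N'_def pair'_def function'_def strictly_increasing'_def infinite'_def finite_sum'_def
  power_of_two'_def binary_expansion'_def lambda'_def mu'_def apart'_def adjacent_sum'_def

lemmas sat_simps = sat.simps teval.simps M0_sel nat.case diff_Suc_Suc diff_zero pair_def[symmetric]

text \<open>Recovers the usual connectives and quantifiers from their encoding by implication,
  falsity and universal quantification.\<close>

lemma classical_simps:
  "(p \<longrightarrow> False) = (\<not> p)" "(\<not> (p \<longrightarrow> \<not> q)) = (p \<and> q)" "(\<not> p \<longrightarrow> q) = (p \<or> q)"
  "(p \<longrightarrow> q) \<and> (q \<longrightarrow> p) \<longleftrightarrow> p = q" "(\<not> (\<forall>x. \<not> P x)) = (\<exists>x. P x)"
  "(\<not> (\<forall>X\<in>S. \<not> Q X)) = (\<exists>X\<in>S. Q X)" "(\<not> False) = True"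
  by auto

lemma sat_RT2:
  "sat (M0 :: 'a::rca0 l2_structure) e E RT2 \<longleftrightarrow>
    (\<forall>k :: 'a. \<forall>f\<in>sets. fun_on f (\<lambda>z. \<exists>x y. x < y \<and> z = pair x y) (\<lambda>y. y < k) \<longrightarrow>
      (\<exists>J\<in>sets. unbounded J \<and> (\<exists>c. c < k \<and>
        (\<forall>x y. x \<in> J \<and> y \<in> J \<and> x < y \<longrightarrow> pair (pair x y) c \<in> f))))"
  unfolding RT2_def RT2_k'_def syntax_defs
  by (simp only: sat_simps classical_simps fun_on_def unbounded_def)

lemma sat_AHT:
  "sat (M0 :: 'a::rca0 l2_structure) e E AHT \<longleftrightarrow>
    (\<forall>k :: 'a. \<forall>c\<in>sets. fun_on c (\<lambda>_. True) (\<lambda>y. y < k) \<longrightarrow>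
      (\<exists>H\<in>sets. unbounded H \<and> (\<forall>x. x \<in> H \<longrightarrow> 0 < x) \<and> apart H \<and>
        (\<exists>i. i < k \<and> (\<forall>x. adj_sum H x \<longrightarrow> pair x i \<in> c))))"
  unfolding AHT_def AHT_k'_def syntax_defs
  by (simp only: sat_simps classical_simps fun_on_def unbounded_def apart_def adj_sum_def bin_exp_def
    pow_rel_def fin_sum_def increasing_def less_eq_rca0)

section \<open>The combinatorial argument\<close>

lemma fun_onD: "fun_on f D R \<Longrightarrow> pair x y \<in> f \<Longrightarrow> D x \<and> R y"
  unfolding fun_on_def by fastforce

lemma fun_on_total: "fun_on f D R \<Longrightarrow> D x \<Longrightarrow> \<exists>y. R y \<and> pair x y \<in> f"
  unfolding fun_on_def by blast

lemma fun_on_unique: "fun_on f D R \<Longrightarrow> pair x y \<in> f \<Longrightarrow> pair x z \<in> f \<Longrightarrow> y = z"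
  using fun_onD[of f D R x y] fun_onD[of f D R x z] unfolding fun_on_def by blast

lemma fun_onI:
  assumes "\<And>z. z \<in> f \<Longrightarrow> \<exists>x y. z = pair x y" "\<And>x y. pair x y \<in> f \<Longrightarrow> D x \<and> R y"
    "\<And>x. D x \<Longrightarrow> \<exists>y. pair x y \<in> f" "\<And>x y z. pair x y \<in> f \<Longrightarrow> pair x z \<in> f \<Longrightarrow> y = z"
  shows "fun_on f D R"
  unfolding fun_on_def
proof (intro conjI allI impI)
  show "\<exists>x y. D x \<and> R y \<and> z = pair x y" if z: "z \<in> f" for z
  proof -
    obtain x y where "z = pair x y" using assms(1)[OF z] by blast
    with z assms(2)[of x y] show ?thesis by blast
  qed
  show "\<exists>y. (R y \<and> pair x y \<in> f) \<and> (\<forall>z. R z \<and> pair x z \<in> f \<longrightarrow> z = y)" if x: "D x" for x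
  proof -
    obtain y where y: "pair x y \<in> f" using assms(3)[OF x] by blast
    with assms(2)[OF y] assms(4) show ?thesis by blast
  qed
qed

lemma triple_ge: "x \<le> pair (pair x y) v" "y \<le> pair (pair x y) v" "v \<le> pair (pair x y) v"
  by (rule order_trans[OF pair_ge(1) pair_ge(1)], rule order_trans[OF pair_ge(2) pair_ge(1)], rule pair_ge(2))

section \<open>Powers of two and their differences\<close>

locale doubling =
  fixes pw :: "'a::rca0 \<Rightarrow> 'a"
  assumes pw_0: "pw 0 = 1" and pw_add_1: "pw (t + 1) = pw t + pw t"
    and pw_set: "{pair t (pw t) |t. True} \<in> sets"
begin

definition Pw :: "'a set" where "Pw = {pair t (pw t) |t. True}"

lemma Pw_sets: "Pw \<in> sets"
  using pw_set by (simp add: Pw_def)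

lemma mem_Pw: "pair t y \<in> Pw \<longleftrightarrow> y = pw t"
  unfolding Pw_def by auto

text \<open>\<open>pw\<close> is no term of the language, so the induction speaks about its value
  through the graph \<open>Pw\<close>; the existential quantifier makes the predicate
  Sigma-1.\<close>

lemma pw_greater: "t < pw t"
proof -
  have "\<exists>y. pair t y \<in> Pw \<and> t < y"
  proof (rule sigma1_induct[where P = "\<lambda>t. \<exists>y. pair t y \<in> Pw \<and> t < y"])
    show "s1 (Suc 0) (\<lambda>e. \<exists>y. pair (e 0) y \<in> Pw \<and> e 0 < y)"
      by (rule s1_ex_d0, intro d0_intros Pw_sets) simp_all
    show "\<exists>y. pair 0 y \<in> Pw \<and> 0 < y" by (simp add: mem_Pw pw_0)
    show "\<exists>y. pair (t + 1) y \<in> Pw \<and> t + 1 < y" if IH: "\<exists>y. pair t y \<in> Pw \<and> t < y" for t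
    proof -
      have "t < pw t" using IH by (simp add: mem_Pw)
      then have "t + 1 \<le> pw t" "0 < pw t" by (auto simp: add_1_le_iff intro: le_less_trans)
      then have "t + 1 < pw t + pw t" by (meson le_less_trans less_add_same_cancel1)
      then show ?thesis by (simp add: mem_Pw pw_add_1)
    qed
  qed
  then show ?thesis by (simp add: mem_Pw)
qed

lemma pw_pos [simp]: "0 < pw t"
  using pw_greater[of t] zero_le le_less_trans by blast

lemma pw_double_le: "x < y \<Longrightarrow> pw x + pw x \<le> pw y"
proof -
  have "\<exists>y. pair (x + c + 1) y \<in> Pw \<and> pw x + pw x \<le> y" for c
  proof (rule sigma1_induct[where P = "\<lambda>c. \<exists>y. pair (x + c + 1) y \<in> Pw \<and> pw x + pw x \<le> y"])
    show "s1 (Suc 0) (\<lambda>e. \<exists>y. pair (x + e 0 + 1) y \<in> Pw \<and> pw x + pw x \<le> y)"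
      by (rule s1_ex_d0, intro d0_intros Pw_sets) simp_all
    show "\<exists>y. pair (x + 0 + 1) y \<in> Pw \<and> pw x + pw x \<le> y" by (simp add: mem_Pw pw_add_1)
    show "\<exists>y. pair (x + (c + 1) + 1) y \<in> Pw \<and> pw x + pw x \<le> y"
      if IH: "\<exists>y. pair (x + c + 1) y \<in> Pw \<and> pw x + pw x \<le> y" for c
    proof -
      have "pw x + pw x \<le> pw (x + c + 1)" using IH by (simp add: mem_Pw)
      then have "pw x + pw x \<le> pw (x + c + 1) + pw (x + c + 1)" by (rule add_increasing2[rotated]) simp
      then have "pw x + pw x \<le> pw (x + (c + 1) + 1)"
        using pw_add_1[of "x + c + 1"] by (simp add: add.assoc)
      then show ?thesis by (simp add: mem_Pw)
    qed
  qed
  then have *: "pw x + pw x \<le> pw (x + c + 1)" for c by (simp add: mem_Pw)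
  assume "x < y"
  then obtain c where "y = x + c + 1" unfolding less_rca0 by auto
  then show ?thesis using * by simp
qed

lemma pw_mono: "x \<le> y \<Longrightarrow> pw x \<le> pw y"
proof (cases "x = y")
  case False
  assume "x \<le> y"
  with False have "x < y" by simp
  then have "pw x + pw x \<le> pw y" by (rule pw_double_le)
  moreover have "pw x \<le> pw x + pw x" by simp
  ultimately show ?thesis by (rule order_trans[rotated])
qed simp

text \<open>The relation \<open>v = 2^y - 2^x\<close>, written additively to avoid truncated
  subtraction.\<close>

definition dif :: "'a \<Rightarrow> 'a \<Rightarrow> 'a \<Rightarrow> bool" where
  "dif x y v \<longleftrightarrow> x < y \<and> v + pw x = pw y"

lemma dif_less: "dif x y v \<Longrightarrow> x < y"
  by (simp add: dif_def)

text \<open>Together with \<open>dif_below\<close> this places \<open>v\<close> between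
  \<open>pw x\<close> and \<open>pw y\<close>, so differences over successive intervals are ordered
  like the intervals.\<close>

lemma dif_ge: "dif x y v \<Longrightarrow> pw x \<le> v"
  unfolding dif_def by (metis add_le_cancel_right pw_double_le)

lemma dif_below: "dif x y v \<Longrightarrow> v < pw y"
  unfolding dif_def by (metis less_add_same_cancel1 pw_pos)

lemma dif_exists: "x < y \<Longrightarrow> \<exists>v. dif x y v"
proof -
  assume "x < y"
  then have "pw x \<le> pw y" using pw_mono by simp
  then obtain v where "pw y = pw x + v" unfolding le_rca0 by auto
  then have "dif x y v" using \<open>x < y\<close> by (simp add: dif_def add.commute)
  then show ?thesis by blast
qed

lemma dif_unique: "dif x y v \<Longrightarrow> dif x y w \<Longrightarrow> v = w"
  unfolding dif_def by (metis add_right_cancel)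

lemma dif_add: "dif x y v \<Longrightarrow> dif y z w \<Longrightarrow> dif x z (v + w)"
  unfolding dif_def by (metis add.assoc add.commute less_trans)

text \<open>Since \<open>pw x\<close> is at most \<open>v\<close>, it is available as a bounded
  witness \<open>a\<close>; with the graph \<open>Pw\<close> as parameter, \<open>dif\<close>
  becomes Delta-0.\<close>

lemma dif_Pw: "dif x y v \<longleftrightarrow> x < y \<and> (\<exists>a. a < v + 1 \<and> pair x a \<in> Pw \<and> pair y (v + a) \<in> Pw)"
  using dif_ge[of x y v] by (auto simp: mem_Pw dif_def)

lemma dif_set: "{pair (pair x y) v |x y v. dif x y v} \<in> sets"
proof -
  have "{z. \<exists>x. x < z + 1 \<and> (\<exists>y. y < z + 1 \<and> (\<exists>v. v < z + 1 \<and> z = pair (pair x y) v \<and> x < y \<and>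
      (\<exists>a. a < v + 1 \<and> pair x a \<in> Pw \<and> pair y (v + a) \<in> Pw)))} \<in> sets"
    by (rule delta0_comprehension, intro d0_intros Pw_sets) simp_all
  moreover have "{pair (pair x y) v |x y v. dif x y v} = {z. \<exists>x. x < z + 1 \<and> (\<exists>y. y < z + 1 \<and>
      (\<exists>v. v < z + 1 \<and> z = pair (pair x y) v \<and> x < y \<and>
      (\<exists>a. a < v + 1 \<and> pair x a \<in> Pw \<and> pair y (v + a) \<in> Pw)))}"
    unfolding dif_Pw[symmetric] using triple_ge by auto
  ultimately show ?thesis by simp
qed

lemma d0_dif:
  assumes "tmd k T" "tmd k U" "tmd k V"
  shows "d0 k (\<lambda>e. dif (T e) (U e) (V e))"
proof -
  have "d0 k (\<lambda>e. pair (pair (T e) (U e)) (V e) \<in> {pair (pair x y) v |x y v. dif x y v})"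
    by (intro d0_intros dif_set assms)
  then show ?thesis by simp
qed

lemmas d0s = d0_intros d0_dif Pw_sets

lemma pow_rel_pw: "pow_rel t (pw t)"
  unfolding pow_rel_def
proof (rule bexI[OF _ Pw_sets], intro conjI allI impI)
  show "fun_on Pw (\<lambda>_. True) (\<lambda>_. True)"
    by (rule fun_onI) (auto simp: mem_Pw, auto simp: Pw_def)
  show "pair (i + 1) ((1 + 1) * u) \<in> Pw" if "pair i u \<in> Pw" for i u
    using that by (simp only: mem_Pw pw_add_1 distrib_right mult_1_left)
qed (simp_all add: mem_Pw pw_0)

text \<open>\<open>2^(x+q+1) - 2^x\<close> is the geometric sum \<open>2^x + ... + 2^(x+q)\<close>,
  so its lowest digit is at \<open>x\<close> and its highest at \<open>x + q\<close>. Expansions are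
  indexed from 1, hence the shift to \<open>i + 1\<close>.\<close>

lemma bin_exp_dif:
  assumes z: "dif x (x + q + 1) z"
  shows "\<exists>t\<in>sets. bin_exp z (q + 1) t \<and> pair 1 x \<in> t \<and> pair (q + 1) (x + q) \<in> t"
proof -
  define t where "t = {pair (i + 1) (x + i) |i. i \<le> q}"
  \<comment> \<open>The partial sum up to \<open>2^(x+i)\<close> is itself the difference
    \<open>2^(x+i+1) - 2^x\<close>, so \<open>s\<close> can be defined without recursion.\<close>
  define s where "s = {pair (i + 1) v |i v. i \<le> q \<and> dif x (x + i + 1) v}"
  have pos: "1 \<le> j \<longleftrightarrow> (\<exists>i. j = i + 1)" for j :: 'a
    using zero_or_add_1[of j] by (auto simp: not_le[symmetric])
  have t: "pair j y \<in> t \<longleftrightarrow> (\<exists>i. i \<le> q \<and> j = i + 1 \<and> y = x + i)" for j y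
    unfolding t_def by auto
  have s: "pair j v \<in> s \<longleftrightarrow> (\<exists>i. i \<le> q \<and> j = i + 1 \<and> dif x (x + i + 1) v)" for j v
    unfolding s_def by auto
  have "{z. \<exists>i. i < q + 1 \<and> z = pair (i + 1) (x + i)} \<in> sets"
    by (rule delta0_comprehension, intro d0s) simp_all
  then have t_sets: "t \<in> sets" unfolding t_def by (simp add: conj_commute)
  have "{z. \<exists>i. i < q + 1 \<and> (\<exists>v. v < z + 1 \<and> z = pair (i + 1) v \<and> dif x (x + i + 1) v)} \<in> sets"
    by (rule delta0_comprehension, intro d0s) simp_all
  moreover have "{z. \<exists>i. i < q + 1 \<and> (\<exists>v. v < z + 1 \<and> z = pair (i + 1) v \<and> dif x (x + i + 1) v)} = s"
    unfolding s_def using pair_ge(2) by auto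
  ultimately have s_sets: "s \<in> sets" by simp
  have "fun_on t (\<lambda>x. 1 \<le> x \<and> x \<le> q + 1) (\<lambda>_. True)"
    by (rule fun_onI) (auto simp: t pos, auto simp: t_def)
  moreover have "increasing t"
    unfolding increasing_def by (auto simp: t add_1_le_iff)
  moreover have "fin_sum (\<lambda>i v. \<exists>e. pair i e \<in> t \<and> pow_rel e v) 1 (q + 1) z"
    unfolding fin_sum_def
  proof (rule bexI[OF _ s_sets], intro conjI allI impI)
    show "fun_on s (\<lambda>x. 1 \<le> x \<and> x \<le> q + 1) (\<lambda>_. True)"
    proof (rule fun_onI)
      show "\<exists>v. pair j v \<in> s" if "1 \<le> j \<and> j \<le> q + 1" for j
      proof -
        obtain i where i: "j = i + 1" using \<open>1 \<le> j \<and> _\<close> pos by blast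
        have "x < x + i + 1" by (rule less_add_1_right)
        then obtain v where "dif x (x + i + 1) v" using dif_exists by blast
        then show ?thesis using i \<open>1 \<le> j \<and> _\<close> by (auto simp: s)
      qed
    qed (auto simp: s pos dest: dif_unique, auto simp: s_def)
    show "\<exists>v. (\<exists>e. pair 1 e \<in> t \<and> pow_rel e v) \<and> pair 1 v \<in> s"
      by (rule exI[of _ "pw x"]) (auto simp: t s pow_rel_pw dif_def pw_add_1)
    show "pair (q + 1) z \<in> s" using z by (auto simp: s)
    fix j assume j: "1 \<le> j \<and> j < q + 1"
    then obtain i where i: "j = i + 1" using pos by blast
    then have iq: "i < q" using j by (simp add: add_1_le_iff)
    have "x < x + i + 1" by (rule less_add_1_right)
    then obtain u where u: "dif x (x + i + 1) u" using dif_exists by blast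
    have "dif (x + i + 1) (x + i + 1 + 1) (pw (x + i + 1))"
      by (auto simp: dif_def pw_add_1)
    then have "dif x (x + i + 1 + 1) (u + pw (x + i + 1))" using dif_add u by blast
    then have "pair (j + 1) (u + pw (x + i + 1)) \<in> s"
      using iq i by (auto simp: s add.assoc add_1_le_iff intro!: exI[of _ "i + 1"])
    moreover have "pair j u \<in> s" using u i iq by (auto simp: s)
    moreover have "pair (j + 1) (x + i + 1) \<in> t"
      using iq i by (auto simp: t add.assoc add_1_le_iff intro!: exI[of _ "i + 1"])
    ultimately show "\<exists>u v. pair j u \<in> s \<and> (\<exists>e. pair (j + 1) e \<in> t \<and> pow_rel e v) \<and> pair (j + 1) (u + v) \<in> s"
      using pow_rel_pw by blast
  qed
  moreover have "1 \<le> q + 1" by simp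
  moreover have "pair 1 x \<in> t" "pair (q + 1) (x + q) \<in> t" by (auto simp: t)
  ultimately show ?thesis using t_sets unfolding bin_exp_def by blast
qed

end

section \<open>Consecutive elements of \<open>J\<close> and the set \<open>H\<close>\<close>

locale doubling_unbounded = doubling +
  fixes J :: "'a set"
  assumes J: "J \<in> sets" "unbounded J"
begin

text \<open>Adjacency in \<open>J\<close> is a bounded condition; with it no enumeration of
  \<open>J\<close> has to be constructed.\<close>

definition adj :: "'a \<Rightarrow> 'a \<Rightarrow> bool" where
  "adj x y \<longleftrightarrow> x \<in> J \<and> y \<in> J \<and> x < y \<and> (\<forall>w. w < y \<longrightarrow> x < w \<longrightarrow> w \<notin> J)"

lemma adj_set: "{pair x y |x y. adj x y} \<in> sets"
proof -
  have "{z. \<exists>x. x < z + 1 \<and> (\<exists>y. y < z + 1 \<and> z = pair x y \<and>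
      x \<in> J \<and> y \<in> J \<and> x < y \<and> (\<forall>w. w < y \<longrightarrow> x < w \<longrightarrow> w \<notin> J))} \<in> sets"
    by (rule delta0_comprehension, intro d0s J) simp_all
  moreover have "{pair x y |x y. adj x y} = {z. \<exists>x. x < z + 1 \<and> (\<exists>y. y < z + 1 \<and> z = pair x y \<and>
      x \<in> J \<and> y \<in> J \<and> x < y \<and> (\<forall>w. w < y \<longrightarrow> x < w \<longrightarrow> w \<notin> J))}"
    unfolding adj_def using pair_ge by auto
  ultimately show ?thesis by simp
qed

lemma d0_adj:
  assumes "tmd k T" "tmd k U"
  shows "d0 k (\<lambda>e. adj (T e) (U e))"
proof -
  have "d0 k (\<lambda>e. pair (T e) (U e) \<in> {pair x y |x y. adj x y})"
    by (intro d0_intros adj_set assms)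
  then show ?thesis by simp
qed

lemma adj_next: "x \<in> J \<Longrightarrow> \<exists>y. adj x y"
proof -
  have "{y. y \<in> J \<and> x < y} \<in> sets"
    by (rule delta0_comprehension, intro d0s J) simp_all
  moreover obtain z where "z \<in> {y. y \<in> J \<and> x < y}" using J(2) unfolding unbounded_def by blast
  ultimately obtain y where "y \<in> {y. y \<in> J \<and> x < y}" "\<And>w. w < y \<Longrightarrow> w \<notin> {y. y \<in> J \<and> x < y}"
    using least_element by blast
  then show "x \<in> J \<Longrightarrow> \<exists>y. adj x y" unfolding adj_def by auto
qed

definition H :: "'a set" where "H = {z. \<exists>x y. adj x y \<and> dif x y z}"

lemma H_sets: "H \<in> sets"
proof -
  \<comment> \<open>The bounds come from \<open>x < 2^x \<le> z\<close> and
    \<open>y < 2^y = z + 2^x \<le> z + z\<close>.\<close>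
  have "{z. \<exists>x. x < z + 1 \<and> (\<exists>y. y < z + z + 1 \<and> adj x y \<and> dif x y z)} \<in> sets"
    by (rule delta0_comprehension, intro d0s d0_adj) simp_all
  moreover have "x \<le> z \<and> y \<le> z + z" if "dif x y z" for x y z
  proof
    show "x \<le> z" using dif_ge[OF that] pw_greater[of x] by simp
    have "y < z + pw x" using that pw_greater[of y] by (simp add: dif_def)
    also have "\<dots> \<le> z + z" using dif_ge[OF that] by simp
    finally show "y \<le> z + z" by simp
  qed
  then have "{z. \<exists>x. x < z + 1 \<and> (\<exists>y. y < z + z + 1 \<and> adj x y \<and> dif x y z)} = H"
    unfolding H_def less_add_1_iff by blast
  ultimately show ?thesis by simp
qed

lemma H_unbounded: "unbounded H"
  unfolding unbounded_def
proof
  fix m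
  obtain x where x: "m < x" "x \<in> J" using J(2) unfolding unbounded_def by blast
  obtain y where y: "adj x y" using adj_next[OF x(2)] by blast
  then obtain z where z: "dif x y z" using dif_exists unfolding adj_def by blast
  have "m < z" using x(1) pw_greater[of x] dif_ge[OF z] by simp
  then show "\<exists>n. m < n \<and> n \<in> H" unfolding H_def using y z by blast
qed

lemma H_pos: "z \<in> H \<Longrightarrow> 0 < z"
  unfolding H_def using dif_ge pw_pos less_le_trans by blast

text \<open>The reverse order of the intervals would give
  \<open>v < pw y' \<le> pw x \<le> u\<close>. Equal left ends have equal right ends, hence equal
  differences; the remaining order gives the claim by adjacency.\<close>

lemma adj_dif_less:
  assumes "adj x y" "dif x y u" "adj x' y'" "dif x' y' v" "u < v"
  shows "y \<le> x'"
proof -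
  consider "x < x'" | "x = x'" | "x' < x" using linorder_less_linear by blast
  then show ?thesis
  proof cases
    case 1
    then show ?thesis using assms(1,3) unfolding adj_def by (meson not_le)
  next
    case 2
    then have "y = y'" using assms(1,3) unfolding adj_def by (metis linorder_less_linear)
    then show ?thesis using 2 assms(2,4,5) dif_unique by blast
  next
    case 3
    then have "y' \<le> x" using assms(1,3) unfolding adj_def by (meson not_le)
    then have "v < pw x" using dif_below[OF assms(4)] pw_mono[of y' x] by simp
    then have "v < u" using dif_ge[OF assms(2)] by simp
    then show ?thesis using assms(5) by simp
  qed
qed

lemma H_apart: "apart H"
  unfolding apart_def
proof (intro allI impI)
  fix z z' assume a: "z \<in> H \<and> z' \<in> H \<and> z < z'"
  then obtain x y x' y' where xy: "adj x y" "dif x y z" "adj x' y'" "dif x' y' z'"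
    unfolding H_def by blast
  obtain q where q: "y = x + q + 1" using dif_less[OF xy(2)] unfolding less_rca0 by auto
  obtain q' where q': "y' = x' + q' + 1" using dif_less[OF xy(4)] unfolding less_rca0 by auto
  have "y \<le> x'" using adj_dif_less xy a by blast
  \<comment> \<open>The highest digit of \<open>z\<close> is at \<open>x + q\<close>, one below
    \<open>y\<close>; so \<open>y \<le> x'\<close> separates the digits even when the intervals
    touch.\<close>
  then have "x + q < x'" unfolding q by (simp add: add_1_le_iff)
  then show "\<exists>m l. (\<exists>p. \<exists>t\<in>sets. bin_exp z p t \<and> pair p m \<in> t) \<and>
      (\<exists>p. \<exists>t\<in>sets. bin_exp z' p t \<and> pair 1 l \<in> t) \<and> m < l"
    using bin_exp_dif[OF xy(2)[unfolded q]] bin_exp_dif[OF xy(4)[unfolded q']] by blast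
qed

text \<open>The enumeration \<open>h\<close> is whatever the formula supplies. Its successive values
  are first shown to come from adjoining intervals; then the partial sums telescope.\<close>

lemma adj_sum_H:
  assumes "adj_sum H z"
  shows "\<exists>x y. x \<in> J \<and> y \<in> J \<and> dif x y z"
proof -
  obtain h a b where h: "h \<in> sets" "fun_on h (\<lambda>i. 1 \<le> i) (\<lambda>_. True)" "increasing h"
    "\<And>y. y \<in> H \<longleftrightarrow> (\<exists>i. 1 \<le> i \<and> pair i y \<in> h)"
    and ab: "1 \<le> a" "a \<le> b" and sum: "fin_sum (\<lambda>m v. pair m v \<in> h) a b z"
    using assms unfolding adj_sum_def by blast
  obtain s where s: "s \<in> sets" "fun_on s (\<lambda>x. a \<le> x \<and> x \<le> b) (\<lambda>_. True)"
    "\<exists>v. pair a v \<in> h \<and> pair a v \<in> s" "pair b z \<in> s"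
    "\<And>i. a \<le> i \<Longrightarrow> i < b \<Longrightarrow> \<exists>u v. pair i u \<in> s \<and> pair (i + 1) v \<in> h \<and> pair (i + 1) (u + v) \<in> s"
    using sum unfolding fin_sum_def by blast
  have h_H: "\<exists>x y. adj x y \<and> dif x y v" if "pair i v \<in> h" for i v
  proof -
    have "1 \<le> i" using fun_onD[OF h(2) that] by blast
    then have "v \<in> H" using h(4) that by blast
    then show ?thesis unfolding H_def by blast
  qed
  \<comment> \<open>If there were a gap from \<open>y\<close> to \<open>x'\<close>, the difference
    \<open>w\<close> over the interval starting at \<open>y\<close> would be an element of
    \<open>H\<close> strictly between \<open>u\<close> and \<open>v\<close>. Its index under
    \<open>h\<close> would lie strictly between \<open>i\<close> and \<open>i + 1\<close>.\<close>
  have consecutive: "x' = y"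
    if "pair i u \<in> h" "pair (i + 1) v \<in> h" "adj x y" "dif x y u" "adj x' y'" "dif x' y' v"
    for i u v x y x' y'
  proof (rule ccontr)
    assume "x' \<noteq> y"
    have "u < v" using h(3) that(1,2) unfolding increasing_def by (metis less_add_1_iff order_refl)
    then have "y \<le> x'" using adj_dif_less that by blast
    then have "y < x'" using \<open>x' \<noteq> y\<close> by simp
    have "y \<in> J" using that(3) unfolding adj_def by blast
    then obtain y'' where y'': "adj y y''" using adj_next by blast
    then obtain w where w: "dif y y'' w" using dif_exists unfolding adj_def by blast
    then have "w \<in> H" using y'' unfolding H_def by blast
    then obtain j where j: "pair j w \<in> h" using h(4) by blast
    have "u < w" using dif_below[OF that(4)] dif_ge[OF w] by simp
    have "y'' \<le> x'" using \<open>y < x'\<close> y'' that(5) unfolding adj_def by (meson not_le)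
    then have "w < v" using dif_below[OF w] dif_ge[OF that(6)] pw_mono[of y'' x'] by simp
    have "i < j"
    proof (rule ccontr)
      assume "\<not> i < j"
      then consider "j = i" | "j < i" by force
      then show False
      proof cases
        case 1
        then show ?thesis using fun_on_unique[OF h(2) j] that(1) \<open>u < w\<close> by blast
      next
        case 2
        then have "w < u" using h(3) j that(1) unfolding increasing_def by blast
        then show ?thesis using \<open>u < w\<close> by simp
      qed
    qed
    then consider "j = i + 1" | "i + 1 < j" using add_1_le_iff[of i j] by force
    then show False
    proof cases
      case 1
      then show ?thesis using fun_on_unique[OF h(2) j] that(2) \<open>w < v\<close> by blast
    next
      case 2
      then have "v < w" using h(3) j that(2) unfolding increasing_def by blast
      then show ?thesis using \<open>w < v\<close> by simp
    qed
  qed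
  obtain v0 where v0: "pair a v0 \<in> h" "pair a v0 \<in> s" using s(3) by blast
  obtain x0 y0 where x0: "adj x0 y0" "dif x0 y0 v0" using h_H[OF v0(1)] by blast
  \<comment> \<open>The interval from \<open>x\<close> to \<open>y\<close> belongs to the last
    summand, and the partial sum \<open>w\<close> up to \<open>n\<close> is
    \<open>2^y - 2^(x0)\<close>. The witnesses stand outside the implication to keep the predicate
    Sigma-1.\<close>
  let ?P = "\<lambda>n. \<exists>w u x y. a \<le> n \<and> n \<le> b \<longrightarrow>
    pair n w \<in> s \<and> pair n u \<in> h \<and> adj x y \<and> dif x y u \<and> dif x0 y w"
  have "?P b"
  proof (rule sigma1_induct[where P = ?P])
    show "s1 (Suc 0) (\<lambda>e. ?P (e 0))"
      by (rule s1_ex, rule s1_ex, rule s1_ex, rule s1_ex_d0, intro d0s d0_adj s(1) h(1)) simp_all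
    \<comment> \<open>The induction starts at 0 while indices start at 1, so this case is vacuous;
      the real base case is \<open>a = n + 1\<close> in the step.\<close>
    have "\<not> a \<le> 0" using ab(1) by auto
    then show "?P 0" by blast
    fix n assume IH: "?P n"
    show "?P (n + 1)"
    proof (cases "a \<le> n + 1 \<and> n + 1 \<le> b")
      case True
      show ?thesis
      proof (cases "a = n + 1")
        case True
        then show ?thesis using v0 x0 by blast
      next
        case False
        then have "a < n + 1" using True by (intro le_neq_trans) auto
        then have n: "a \<le> n" "n < b" using True by (simp_all add: add_1_le_iff)
        then have "n \<le> b" by simp
        then obtain w u x y where w: "pair n w \<in> s" "pair n u \<in> h" "adj x y" "dif x y u" "dif x0 y w"
          using IH n(1) by blast
        obtain w' v where v: "pair n w' \<in> s" "pair (n + 1) v \<in> h" "pair (n + 1) (w' + v) \<in> s"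
          using s(5)[OF n] by blast
        have "w' = w" using fun_on_unique[OF s(2)] v(1) w(1) by blast
        obtain x' y' where xy': "adj x' y'" "dif x' y' v" using h_H[OF v(2)] by blast
        have "x' = y" using consecutive[OF w(2) v(2) w(3,4) xy'] .
        then have "dif x0 y' (w + v)" using dif_add[OF w(5)] xy'(2) by blast
        then show ?thesis using v xy' \<open>w' = w\<close> by blast
      qed
    qed blast
  qed
  then obtain w x y where "pair b w \<in> s" "adj x y" "dif x0 y w" using ab(2) by blast
  moreover from this have "w = z" using fun_on_unique[OF s(2)] s(4) by blast
  ultimately show ?thesis using x0 unfolding adj_def by blast
qed

end

theorem RT2_imp_AHT:
  assumes RT2: "sat (M0 :: 'a::rca0 l2_structure) e E RT2"
  shows "sat (M0 :: 'a l2_structure) e E AHT"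
  unfolding sat_AHT
proof (intro allI ballI impI)
  fix k :: 'a and c assume c: "c \<in> sets" "fun_on c (\<lambda>_. True) (\<lambda>y. y < k)"
  obtain pw :: "'a \<Rightarrow> 'a" where "doubling pw"
    using power_of_two_exists[where 'a = 'a] unfolding doubling_def by blast
  then interpret doubling pw .
  let ?F = "\<lambda>z. \<exists>x y i v. z = pair (pair x y) i \<and> dif x y v \<and> pair v i \<in> c"
  have F: "?F (pair (pair x y) i) \<longleftrightarrow> pair v i \<in> c" if "dif x y v" for x y i v
    using that dif_unique by auto
  define f where "f = {z. ?F z}"
  have "f \<in> sets"
    unfolding f_def
  proof (rule delta1_comprehension)
    show "s1 (Suc 0) (\<lambda>e. ?F (e 0))"
      by (rule s1_ex, rule s1_ex, rule s1_ex, rule s1_ex_d0, intro d0s c) simp_all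
    \<comment> \<open>For \<open>x < y\<close> the difference \<open>v\<close> exists and is unique,
      so the complement is Sigma-1 too: either \<open>c\<close> does not give \<open>v\<close> the
      colour \<open>i\<close>, or \<open>z\<close> has no decomposition into \<open>x < y\<close>
      and \<open>i\<close>.\<close>
    let ?G = "\<lambda>z. \<exists>x y i v. z = pair (pair x y) i \<and> dif x y v \<and> pair v i \<notin> c \<or>
      \<not> (\<exists>x. x < z + 1 \<and> (\<exists>y. y < z + 1 \<and> (\<exists>i. i < z + 1 \<and> z = pair (pair x y) i \<and> x < y)))"
    have "s1 (Suc 0) (\<lambda>e. ?G (e 0))"
      by (rule s1_ex, rule s1_ex, rule s1_ex, rule s1_ex_d0, intro d0s c) simp_all
    moreover have "\<not> ?F z \<longleftrightarrow> ?G z" for z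
    proof (cases "\<exists>x y i. z = pair (pair x y) i \<and> x < y")
      case True
      then obtain x y i where z: "z = pair (pair x y) i" and "x < y" by blast
      then obtain v where v: "dif x y v" using dif_exists by blast
      have "x \<le> z" "y \<le> z" "i \<le> z" unfolding z by (rule triple_ge)+
      then have "\<exists>x. x < z + 1 \<and> (\<exists>y. y < z + 1 \<and> (\<exists>i. i < z + 1 \<and> z = pair (pair x y) i \<and> x < y))"
        using z \<open>x < y\<close> by auto
      then have "?G z \<longleftrightarrow> pair v i \<notin> c" unfolding z using v dif_unique by auto
      then show ?thesis using F[OF v] z by simp
    next
      case False
      then have "\<not> ?F z" using dif_less by blast
      moreover have "?G z" using False by blast
      ultimately show ?thesis by blast
    qed
    ultimately show "s1 (Suc 0) (\<lambda>e. \<not> ?F (e 0))" by simp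
  qed
  moreover have "fun_on f (\<lambda>z. \<exists>x y. x < y \<and> z = pair x y) (\<lambda>y. y < k)"
    unfolding f_def
  proof (rule fun_onI)
    show "\<exists>x y. z = pair x y" if "z \<in> {z. ?F z}" for z using that by blast
    show "(\<exists>x y. x < y \<and> p = pair x y) \<and> i < k" if "pair p i \<in> {z. ?F z}" for p i
      using that fun_onD[OF c(2)] dif_less by auto
    show "\<exists>i. pair p i \<in> {z. ?F z}" if "\<exists>x y. x < y \<and> p = pair x y" for p
      using that fun_on_total[OF c(2)] dif_exists by (auto, metis)
    show "i = j" if ij: "pair p i \<in> {z. ?F z}" "pair p j \<in> {z. ?F z}" for p i j
    proof -
      obtain x y v where "p = pair x y" and v: "dif x y v" "pair v i \<in> c" using ij(1) by auto
      then have "pair v j \<in> c" using ij(2) F by simp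
      then show ?thesis using fun_on_unique[OF c(2) v(2)] by blast
    qed
  qed
  ultimately have "\<exists>J\<in>sets. unbounded J \<and> (\<exists>i. i < k \<and>
      (\<forall>x y. x \<in> J \<and> y \<in> J \<and> x < y \<longrightarrow> pair (pair x y) i \<in> f))"
    by (rule RT2[unfolded sat_RT2, rule_format])
  then obtain J i where J: "J \<in> sets" "unbounded J" and i: "i < k"
    "\<And>x y. x \<in> J \<Longrightarrow> y \<in> J \<Longrightarrow> x < y \<Longrightarrow> pair (pair x y) i \<in> f"
    by blast
  interpret doubling_unbounded pw J by unfold_locales (rule J)+
  have "pair z i \<in> c" if "adj_sum H z" for z
  proof -
    obtain x y where "x \<in> J" "y \<in> J" "dif x y z" using adj_sum_H[OF \<open>adj_sum H z\<close>] by blast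
    then have "pair (pair x y) i \<in> f" using i(2) dif_less by blast
    then show ?thesis using F[OF \<open>dif x y z\<close>] unfolding f_def by blast
  qed
  then show "\<exists>H\<in>sets. unbounded H \<and> (\<forall>x. x \<in> H \<longrightarrow> 0 < x) \<and> apart H \<and>
      (\<exists>i. i < k \<and> (\<forall>x. adj_sum H x \<longrightarrow> pair x i \<in> c))"
    using H_sets H_unbounded H_pos H_apart i(1) by blast
qed

section \<open>A generic countermodel\<close>

definition nat_structure :: "nat l2_structure" where
  "nat_structure = \<lparr>zeroM = 0, oneM = 1, addM = (+), mulM = (*), lessM = (<), setsM = UNIV\<rparr>"

definition rca0_model :: "'a l2_structure \<Rightarrow> bool" where
  "rca0_model M \<longleftrightarrow> setsM M \<noteq> {} \<and> (\<forall>p\<in>RCA0. models M p)"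

text \<open>The standard model with all sets ensures that a model can be chosen even if there is no
  countermodel, as the unconditional class instance below requires.\<close>

lemma rca0_model_nat: "rca0_model nat_structure"
  unfolding rca0_model_def
proof (intro conjI ballI)
  show "setsM nat_structure \<noteq> {}" by (simp add: nat_structure_def)
  fix p assume "p \<in> RCA0"
  then consider "p \<in> basic_axioms" | q where "p \<in> closures (induction_axiom q)"
    | q r where "p \<in> closures (comprehension_axiom q r)"
    unfolding RCA0_def by blast
  then show "models nat_structure p"
  proof cases
    case 1
    then show ?thesis
      unfolding basic_axioms_def syntax_defs
      by (auto simp: models_def nat_structure_def)
  next
    case (2 q)
    have "models nat_structure (induction_axiom q)"
      unfolding models_def sat_induction_axiom
    proof (intro allI impI)
      fix e and E :: "nat \<Rightarrow> nat set" and x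
      assume "sat nat_structure (case_nat (zeroM nat_structure) e) E q"
        "\<forall>x. sat nat_structure (case_nat x e) E q \<longrightarrow>
          sat nat_structure (case_nat (addM nat_structure x (oneM nat_structure)) e) E q"
      then show "sat nat_structure (case_nat x e) E q"
        by (induction x) (simp_all add: nat_structure_def)
    qed
    then show ?thesis by (simp add: models_closures[OF 2])
  next
    case (3 q r)
    have "models nat_structure (comprehension_axiom q r)"
      unfolding models_def sat_comprehension_axiom
    proof (intro allI impI)
      fix e and E :: "nat \<Rightarrow> nat set"
      show "\<exists>X\<in>setsM nat_structure. \<forall>x. x \<in> X \<longleftrightarrow> sat nat_structure (case_nat x e) E q"
        by (rule bexI[of _ "{x. sat nat_structure (case_nat x e) E q}"]) (simp_all add: nat_structure_def)
    qed
    then show ?thesis by (simp add: models_closures[OF 3])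
  qed
qed

text \<open>A countermodel if there is one. Its operations become those of a type, so that the
development above, which uses the type class \<open>rca0\<close>, applies to it.\<close>

definition chosen :: "nat l2_structure" where
  "chosen = (SOME M. rca0_model M \<and>
     ((\<exists>N :: nat l2_structure. rca0_model N \<and> \<not> models N (Imp RT2 AHT)) \<longrightarrow> \<not> models M (Imp RT2 AHT)))"

lemma chosen:
  "rca0_model chosen"
  "rca0_model (N :: nat l2_structure) \<Longrightarrow> \<not> models N (Imp RT2 AHT) \<Longrightarrow> \<not> models chosen (Imp RT2 AHT)"
proof -
  have "\<exists>M :: nat l2_structure. rca0_model M \<and>
     ((\<exists>N :: nat l2_structure. rca0_model N \<and> \<not> models N (Imp RT2 AHT)) \<longrightarrow> \<not> models M (Imp RT2 AHT))"
    using rca0_model_nat by blast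
  from someI_ex[OF this] show "rca0_model chosen"
    "rca0_model (N :: nat l2_structure) \<Longrightarrow> \<not> models N (Imp RT2 AHT) \<Longrightarrow> \<not> models chosen (Imp RT2 AHT)"
    unfolding chosen_def by blast+
qed

text \<open>A fresh copy of \<open>nat\<close>: on \<open>nat\<close> itself the operation symbols
  already have their standard meaning and could not denote the operations of
  \<open>chosen\<close>.\<close>

datatype model = Elem (elem: nat)

instantiation model :: l2
begin

definition "0 = Elem (zeroM chosen)"
definition "1 = Elem (oneM chosen)"
definition "a + b = Elem (addM chosen (elem a) (elem b))"
definition "a * b = Elem (mulM chosen (elem a) (elem b))"
definition "a < b \<longleftrightarrow> lessM chosen (elem a) (elem b)"
definition "a \<le> b \<longleftrightarrow> a < b \<or> a = b" for a b :: model
definition "a - b = (if \<exists>c. a = b + c then THE c. a = b + c else 0)" for a b :: model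
definition "sets = (`) Elem ` setsM chosen"

instance ..

end

lemma teval_model: "teval M0 (\<lambda>i. Elem (e i)) t = Elem (teval chosen e t)"
  by (induction t) (simp_all add: zero_model_def one_model_def plus_model_def times_model_def)

lemma sat_model: "sat M0 (\<lambda>i. Elem (e i)) (\<lambda>i. Elem ` E i) p \<longleftrightarrow> sat chosen e E p"
proof (induction p arbitrary: e E)
  case (AllN p)
  have "case_nat (Elem n) (\<lambda>i. Elem (e i)) = (\<lambda>i. Elem (case_nat n e i))" for n
    by (auto simp: fun_eq_iff split: nat.split)
  then have "sat M0 (case_nat (Elem n) (\<lambda>i. Elem (e i))) (\<lambda>i. Elem ` E i) p \<longleftrightarrow>
      sat chosen (case_nat n e) E p" for n
    using AllN.IH by simp
  then show ?case by (metis model.exhaust sat.simps(6))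
next
  case (AllS p)
  have "case_nat (Elem ` X) (\<lambda>i. Elem ` E i) = (\<lambda>i. Elem ` case_nat X E i)" for X
    by (auto simp: fun_eq_iff split: nat.split)
  then have "sat M0 (\<lambda>i. Elem (e i)) (case_nat (Elem ` X) (\<lambda>i. Elem ` E i)) p \<longleftrightarrow>
      sat chosen e (case_nat X E) p" for X
    using AllS.IH by simp
  then show ?case by (simp add: sets_model_def)
qed (auto simp: teval_model less_model_def)

lemma models_model: "models (M0 :: model l2_structure) p \<longleftrightarrow> models chosen p"
proof
  assume M0: "models (M0 :: model l2_structure) p"
  show "models chosen p"
    unfolding models_def
  proof (intro allI impI)
    fix e and E :: "nat \<Rightarrow> nat set" assume "range E \<subseteq> setsM chosen"
    then have "range (\<lambda>i. Elem ` E i) \<subseteq> setsM M0" by (auto simp: sets_model_def)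
    then show "sat chosen e E p" using M0 unfolding models_def sat_model[symmetric] by blast
  qed
next
  assume chosen: "models chosen p"
  show "models (M0 :: model l2_structure) p"
    unfolding models_def
  proof (intro allI impI)
    fix e :: "nat \<Rightarrow> model" and E :: "nat \<Rightarrow> model set" assume "range E \<subseteq> setsM M0"
    then have "E i \<in> (`) Elem ` setsM chosen" for i by (auto simp: sets_model_def)
    then have "\<forall>i. \<exists>X\<in>setsM chosen. E i = Elem ` X" by blast
    then obtain F where F: "\<forall>i. F i \<in> setsM chosen" "\<forall>i. E i = Elem ` F i" by metis
    then have "E = (\<lambda>i. Elem ` F i)" "range F \<subseteq> setsM chosen" by auto
    moreover have "e = (\<lambda>i. Elem (elem (e i)))" by simp
    ultimately show "sat M0 e E p" using chosen sat_model unfolding models_def by metis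
  qed
qed

instance model :: rca0
proof
  show "(sets :: model set set) \<noteq> {}" using chosen(1) by (simp add: sets_model_def rca0_model_def)
  show "models (M0 :: model l2_structure) p" if "p \<in> RCA0" for p
    using chosen(1) that unfolding models_model rca0_model_def by blast
qed (simp_all only: less_eq_model_def minus_model_def)

lemma closures_below: "q \<in> closures p \<Longrightarrow> fm_below 0 0 q"
proof -
  have S: "fm_below m b ((AllS ^^ k) p) \<longleftrightarrow> fm_below m (b + k) p" for m b k p
    by (induction k arbitrary: b) auto
  have N: "fm_below b k ((AllN ^^ m) p) \<longleftrightarrow> fm_below (b + m) k p" for m b k p
    by (induction m arbitrary: b) auto
  show "q \<in> closures p \<Longrightarrow> ?thesis" unfolding closures_def by (auto simp: S N)
qed

text \<open>If some model of the base theory on \<open>nat\<close> refuted the implication, so would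
  \<open>chosen\<close>, and hence its isomorphic copy on the type \<open>model\<close>, where
  \<open>RT2_imp_AHT\<close> excludes this.\<close>

theorem corollary1: "RCA0 \<turnstile> Imp RT2 AHT"
proof (rule completeness)
  show "basic_axioms \<subseteq> RCA0" unfolding RCA0_def by blast
  have "\<forall>q\<in>basic_axioms. fm_below 0 0 q"
    unfolding basic_axioms_def syntax_defs by simp
  then show "\<forall>q\<in>RCA0. fm_below 0 0 q" unfolding RCA0_def using closures_below by blast
  show "fm_below 0 0 (Imp RT2 AHT)"
    unfolding RT2_def RT2_k'_def AHT_def AHT_k'_def syntax_defs by simp
  fix M :: "nat l2_structure" assume M: "setsM M \<noteq> {}" "\<And>q. q \<in> RCA0 \<Longrightarrow> models M q"
  have "models (M0 :: model l2_structure) (Imp RT2 AHT)"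
    unfolding models_def sat.simps using RT2_imp_AHT by blast
  then show "models M (Imp RT2 AHT)"
    using chosen(2)[of M] M unfolding models_model rca0_model_def by blast
qed

end
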